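(* Let $G$ be a bridgeless graph. For every $p\in[1,\infty]$, $$\phi_{3,p}(G)\le 1+\min\{g_1(p),g_2(p),g_3(p)\}\le 1+\sqrt2,$$ where $g_1(p)=\frac54\cdot 2^{1-1/p}$, $g_2(p)=\bigl[(2^{-1/p}+3^{-1/p})^p+(2^{-1/p}-3^{-1/p})^p+\tfrac13\bigr]^{1/p}$, and $g_3(p)=2^{1/p}$ (values at $p=\infty$ being interpreted as limits as $p\to\infty$).
   Context: All graphs are finite and may have multiple edges but no loops. For an orientation $D$ of a graph $G$ and a vertex $v$, $E_D^+(v)$ and $E_D^-(v)$ denote the sets of edges directed out of and into $v$. For $\Omega\subseteq\mathbb{R}^d$, a vector $\Omega$-flow of $G$ is a pair $(D,f)$ where $D$ is an orientation of $G$ and $f:E(G)\to\Omega$ satisfies $\sum_{e\in E_D^+(v)}f(e)-\sum_{e\in E_D^-(v)}f(e)=\mathbf{0}$ for every vertex $v$. For $p\in[1,\infty)$, $\|x\|_p=(|x_1|^p+\dots+|x_d|^p)^{1/p}$ and $\|x\|_\infty=\max_i|x_i|$. For an integer $d\ge1$, a real $r\ge 2$ and $p\in[1,\infty]$, an $(r,d,p)$-NZF of $G$ is a vector $(\mathbb{R}^d\setminus\{\mathbf{0}\})$-flow $(D,f)$ with $1\le\|f(e)\|_p\le r-1$ for every edge $e$. For a bridgeless graph $G$, $\phi_{d,p}(G)$ is the infimum of all real $r$ for which $G$ admits an $(r,d,p)$-NZF. *)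

theory Defs
  imports "HOL-Analysis.Analysis" "HOL-Real_Asymp.Real_Asymp" "Graph_Theory.Digraph"
begin

record ('v, 'e) multigraph =
  mverts :: "'v set"
  medges :: "'e set"
  mends :: "'e \<Rightarrow> 'v set"

definition finite_loopless_multigraph :: "('v, 'e) multigraph \<Rightarrow> bool" where
  "finite_loopless_multigraph G \<longleftrightarrow>
     finite (mverts G) \<and> finite (medges G) \<and>
     (\<forall>e\<in>medges G. mends G e \<subseteq> mverts G \<and> card (mends G e) = 2)"

definition adjacency :: "('v, 'e) multigraph \<Rightarrow> ('v \<times> 'v) set" where
  "adjacency G = {(u, v). \<exists>e\<in>medges G. mends G e = {u, v}}"

definition graph_components :: "('v, 'e) multigraph \<Rightarrow> 'v set set" where
  "graph_components G = mverts G // ((adjacency G)\<^sup>* \<inter> mverts G \<times> mverts G)"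

definition delete_edge :: "('v, 'e) multigraph \<Rightarrow> 'e \<Rightarrow> ('v, 'e) multigraph" where
  "delete_edge G e = G\<lparr>medges := medges G - {e}\<rparr>"

definition bridge :: "('v, 'e) multigraph \<Rightarrow> 'e \<Rightarrow> bool" where
  "bridge G e \<longleftrightarrow> e \<in> medges G \<and> card (graph_components G) < card (graph_components (delete_edge G e))"

definition bridgeless :: "('v, 'e) multigraph \<Rightarrow> bool" where
  "bridgeless G \<longleftrightarrow> (\<nexists>e. bridge G e)"

text \<open>An orientation is a digraph on the same vertices and the same edge names, so that
  \<open>out_arcs D v\<close> and \<open>in_arcs D v\<close> are $E_D^+(v)$ and $E_D^-(v)$.\<close>

definition orientation :: "('v, 'e) multigraph \<Rightarrow> ('v, 'e) pre_digraph \<Rightarrow> bool" where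
  "orientation G D \<longleftrightarrow>
     verts D = mverts G \<and> arcs D = medges G \<and>
     (\<forall>e\<in>medges G. mends G e = {tail D e, head D e})"

definition vector_flow ::
  "(real ^ 'd) set \<Rightarrow> ('v, 'e) multigraph \<Rightarrow> ('v, 'e) pre_digraph \<Rightarrow> ('e \<Rightarrow> real ^ 'd) \<Rightarrow> bool" where
  "vector_flow \<Omega> G D f \<longleftrightarrow>
     orientation G D \<and> (\<forall>e\<in>medges G. f e \<in> \<Omega>) \<and>
     (\<forall>v\<in>mverts G. (\<Sum>e\<in>out_arcs D v. f e) - (\<Sum>e\<in>in_arcs D v. f e) = 0)"

definition pnorm :: "ereal \<Rightarrow> real ^ 'd \<Rightarrow> real" where
  "pnorm p x =
     (if p = \<infinity> then MAX i. \<bar>x $ i\<bar>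
      else (\<Sum>i\<in>UNIV. \<bar>x $ i\<bar> powr real_of_ereal p) powr (1 / real_of_ereal p))"

definition NZF ::
  "real \<Rightarrow> ereal \<Rightarrow> ('v, 'e) multigraph \<Rightarrow> ('v, 'e) pre_digraph \<Rightarrow> ('e \<Rightarrow> real ^ 'd) \<Rightarrow> bool" where
  "NZF r p G D f \<longleftrightarrow>
     2 \<le> r \<and> 1 \<le> p \<and> vector_flow (UNIV - {0}) G D f \<and>
     (\<forall>e\<in>medges G. 1 \<le> pnorm p (f e) \<and> pnorm p (f e) \<le> r - 1)"

text \<open>The dimension $d$ is the cardinality of the index type \<open>'d\<close>.  The infimum is taken in
  the extended reals, where the infimum of the empty set is \<open>\<infinity>\<close>; a finite upper bound on
  \<open>flow_number\<close> therefore entails that some flow exists.\<close>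

definition flow_number :: "'d::finite itself \<Rightarrow> ereal \<Rightarrow> ('v, 'e) multigraph \<Rightarrow> ereal" where
  "flow_number _ p G =
     (INF r \<in> {r. \<exists>D (f :: 'e \<Rightarrow> real ^ 'd). NZF r p G D f}. ereal r)"

text \<open>The value at \<open>p = \<infinity>\<close> of a function of a real exponent is its limit; \<open>Lim\<close> is
  only meaningful if that limit exists, see the lemmas below.\<close>

definition extend_at_infinity :: "(real \<Rightarrow> real) \<Rightarrow> ereal \<Rightarrow> real" where
  "extend_at_infinity g p = (if p = \<infinity> then Lim at_top g else g (real_of_ereal p))"

definition g1 :: "ereal \<Rightarrow> real" where
  "g1 = extend_at_infinity (\<lambda>p. 5 / 4 * 2 powr (1 - 1 / p))"

definition g2 :: "ereal \<Rightarrow> real" where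
  "g2 = extend_at_infinity (\<lambda>p.
     ((2 powr (- 1 / p) + 3 powr (- 1 / p)) powr p
      + (2 powr (- 1 / p) - 3 powr (- 1 / p)) powr p + 1 / 3) powr (1 / p))"

definition g3 :: "ereal \<Rightarrow> real" where
  "g3 = extend_at_infinity (\<lambda>p. 2 powr (1 / p))"

lemma g1_infinity: "g1 \<infinity> = 5 / 2"
proof -
  have "((\<lambda>p::real. 5 / 4 * 2 powr (1 - 1 / p)) \<longlongrightarrow> (5 / 2 :: real)) at_top"
    by real_asymp
  then show ?thesis
    by (simp add: g1_def extend_at_infinity_def tendsto_Lim)
qed

lemma g2_infinity: "g2 \<infinity> = 2"
proof -
  have "((\<lambda>p::real. ((2 powr (- 1 / p) + 3 powr (- 1 / p)) powr p
      + (2 powr (- 1 / p) - 3 powr (- 1 / p)) powr p + 1 / 3) powr (1 / p)) \<longlongrightarrow> (2 :: real)) at_top"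
    by real_asymp
  then show ?thesis
    by (simp add: g2_def extend_at_infinity_def tendsto_Lim)
qed

lemma g3_infinity: "g3 \<infinity> = 1"
proof -
  have "((\<lambda>p::real. 2 powr (1 / p)) \<longlongrightarrow> (1 :: real)) at_top"
    by real_asymp
  then show ?thesis
    by (simp add: g3_def extend_at_infinity_def tendsto_Lim)
qed

end

theory Submission
  imports Defs
begin

text \<open>Seymour's 6-flow theorem yields a 2-flow \<open>x\<close> with values in $\{-1,0,1\}$ and an integer 3-flow
  without common zero.  The 3-flow splits as \<open>a + b\<close> with $(a,b)\in\pm\{(0,0),(1,0),(0,1),(1,1)\}$, so for
  vectors \<open>u\<close>, \<open>v\<close>, \<open>w\<close> the flow \<open>x u + a v + b w\<close> only takes the values
  $\pm u$, the ``hexagon'' $\pm v,\pm w,\pm(v+w)$, and the sums of these, up to sign.  The three bounds come from three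
  choices of the hexagon and of \<open>u\<close>: coordinates split as $1+2$ for $g_3$, the hexagon in the
  plane $x+y+z=0$ and \<open>u\<close> along its normal for $g_2$, and an irregular integer hexagon for $g_1$.

  Paths and circuits are avoided throughout the proof of the 6-flow theorem: edge connectivity is
  expressed by cuts, and Hoffman's circulation theorem (proved by uncrossing tight sets) replaces
  Menger's theorem, Eulerian orientations and Tutte's passage from modular to integer flows.\<close>

subsection \<open>Integer flows with prescribed demands\<close>

text \<open>The end maps \<open>t\<close> and \<open>h\<close> are plain functions, so that
  contracting vertices is composition with a map \<open>p\<close>, and net flow in the contraction
  is net flow over preimages. Loops created in this way are harmless: their two terms
  cancel.\<close>

definition netflow :: "'e set \<Rightarrow> ('e \<Rightarrow> 'v) \<Rightarrow> ('e \<Rightarrow> 'v) \<Rightarrow> ('e \<Rightarrow> 'a::ab_group_add) \<Rightarrow> 'v set \<Rightarrow> 'a" where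
  "netflow E t h f A = (\<Sum>e\<in>E. (if t e \<in> A then f e else 0) - (if h e \<in> A then f e else 0))"

definition edge_cut :: "'e set \<Rightarrow> ('e \<Rightarrow> 'v) \<Rightarrow> ('e \<Rightarrow> 'v) \<Rightarrow> 'v set \<Rightarrow> 'e set" where
  "edge_cut E t h S = {e \<in> E. (t e \<in> S) \<noteq> (h e \<in> S)}"

lemma finite_edge_cut: "finite E \<Longrightarrow> finite (edge_cut E t h S)"
  by (simp add: edge_cut_def)

lemma netflow_sum_vertices:
  assumes "finite A"
  shows "(\<Sum>v\<in>A. netflow E t h f {v}) = netflow E t h f A"
proof -
  have "(\<Sum>v\<in>A. netflow E t h f {v}) =
      (\<Sum>e\<in>E. \<Sum>v\<in>A. (if t e \<in> {v} then f e else 0) - (if h e \<in> {v} then f e else 0))"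
    unfolding netflow_def by (rule sum.swap)
  also have "\<dots> = netflow E t h f A"
    unfolding netflow_def using assms by (intro sum.cong refl) (simp add: sum_subtractf sum.delta')
  finally show ?thesis .
qed

lemma netflow_cong:
  assumes "\<And>e. e \<in> E \<Longrightarrow> f e = g e"
  shows "netflow E t h f A = netflow E t h g A"
  unfolding netflow_def using assms by (intro sum.cong) auto

lemma netflow_add: "netflow E t h (\<lambda>e. f e + g e) A = netflow E t h f A + netflow E t h g A"
  unfolding netflow_def sum.distrib[symmetric] by (intro sum.cong) auto

lemma netflow_diff: "netflow E t h (\<lambda>e. f e - g e) A = netflow E t h f A - netflow E t h g A"
  unfolding netflow_def sum_subtractf[symmetric] by (intro sum.cong) auto

lemma netflow_mult:
  fixes c :: "'a::comm_ring_1"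
  shows "netflow E t h (\<lambda>e. c * f e) A = c * netflow E t h f A"
  unfolding netflow_def sum_distrib_left by (intro sum.cong) (auto simp: algebra_simps)

lemma netflow_edge_cut:
  "finite E \<Longrightarrow> netflow E t h f A = (\<Sum>e\<in>edge_cut E t h A. if t e \<in> A then f e else - f e)"
  unfolding netflow_def edge_cut_def
  by (rule sum.mono_neutral_cong_right) auto

lemma netflow_vertices_eq_0:
  assumes "finite V" "\<And>e. e \<in> E \<Longrightarrow> t e \<in> V \<and> h e \<in> V"
  shows "netflow E t h f V = 0"
  unfolding netflow_def using assms by (intro sum.neutral) auto

lemma netflow_dvd_diff:
  fixes k :: "'a::comm_ring_1"
  assumes "\<And>e. e \<in> E \<Longrightarrow> t e \<in> A \<or> h e \<in> A \<Longrightarrow> k dvd f e - g e"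
  shows "k dvd netflow E t h f A - netflow E t h g A"
  unfolding netflow_diff[symmetric] unfolding netflow_def
  using assms by (intro dvd_sum) auto

lemma netflow_vimage: "netflow E (\<lambda>e. p (t e)) (\<lambda>e. p (h e)) f A = netflow E t h f (p -` A)"
  by (simp add: netflow_def)

lemma edge_cut_vimage: "edge_cut E (\<lambda>e. p (t e)) (\<lambda>e. p (h e)) A = edge_cut E t h (p -` A)"
  by (simp add: edge_cut_def)

lemma netflow_cong_incident:
  assumes "\<And>e. e \<in> E \<Longrightarrow> t e \<in> A \<or> h e \<in> A \<Longrightarrow> f e = g e"
  shows "netflow E t h f A = netflow E t h g A"
  unfolding netflow_def using assms by (intro sum.cong) auto

lemma netflow_mono_neutral:
  assumes "finite E" "X \<subseteq> E"
  shows "netflow E t h (\<lambda>e. if e \<in> X then g e else 0) A = netflow X t h g A"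
  unfolding netflow_def using assms by (intro sum.mono_neutral_cong_right) auto

lemma netflow_single:
  assumes "finite E" "e \<in> E"
  shows "netflow E t h (\<lambda>x. if x = e then a else 0) A = (if t e \<in> A then a else 0) - (if h e \<in> A then a else 0)"
proof -
  have "netflow E t h (\<lambda>x. if x = e then a else 0) A = netflow {e} t h (\<lambda>_. a) A"
    using assms netflow_mono_neutral[of E "{e}" t h "\<lambda>_. a" A] by simp
  then show ?thesis by (simp add: netflow_def)
qed

abbreviation ind :: "'e set \<Rightarrow> 'e \<Rightarrow> int" where
  "ind X \<equiv> \<lambda>e. if e \<in> X then 1 else 0"

text \<open>The largest net outflow from \<open>S\<close> that the bounds allow edge by edge, so
  \<open>sum b S \<le> cut_capacity E t h l c S\<close> is Hoffman's necessary condition for the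
  demands \<open>b\<close>.\<close>

definition cut_capacity :: "'e set \<Rightarrow> ('e \<Rightarrow> 'v) \<Rightarrow> ('e \<Rightarrow> 'v) \<Rightarrow> ('e \<Rightarrow> int) \<Rightarrow> ('e \<Rightarrow> int) \<Rightarrow> 'v set \<Rightarrow> int" where
  "cut_capacity E t h l c S =
     (\<Sum>e\<in>E. if t e \<in> S \<and> h e \<notin> S then c e else if h e \<in> S \<and> t e \<notin> S then - l e else 0)"

lemma cut_capacity_const: "finite E \<Longrightarrow> cut_capacity E t h (\<lambda>_. - n) (\<lambda>_. n) S = n * int (card (edge_cut E t h S))"
proof -
  assume "finite E"
  then have "cut_capacity E t h (\<lambda>_. - n) (\<lambda>_. n) S = (\<Sum>e\<in>edge_cut E t h S. n)"
    unfolding cut_capacity_def edge_cut_def by (intro sum.mono_neutral_cong_right) auto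
  then show ?thesis by simp
qed

text \<open>Hoffman's circulation theorem with demands.  An edge with \<open>l e < c e\<close> can be narrowed:
  otherwise a tight set entered by it and a tight set left by it contradict submodularity.\<close>

lemma feasible_flow:
  fixes b :: "'v \<Rightarrow> int"
  assumes fin: "finite E" "finite V" and inV: "\<And>e. e \<in> E \<Longrightarrow> t e \<in> V \<and> h e \<in> V"
    and "\<And>e. e \<in> E \<Longrightarrow> l e \<le> c e" and b0: "sum b V = 0"
    and "\<And>S. S \<subseteq> V \<Longrightarrow> sum b S \<le> cut_capacity E t h l c S"
  shows "\<exists>f. (\<forall>e\<in>E. l e \<le> f e \<and> f e \<le> c e) \<and> (\<forall>v\<in>V. netflow E t h f {v} = b v)"
  using assms(4,6)
proof (induction "nat (\<Sum>e\<in>E. c e - l e)" arbitrary: l c rule: less_induct)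
  case less
  note lc = less.prems(1) and tight = less.prems(2)
  show ?case
  proof (cases "\<forall>e\<in>E. l e = c e")
    case True
    have capl: "cut_capacity E t h l c S = netflow E t h l S" for S
      unfolding cut_capacity_def netflow_def using True by (intro sum.cong) auto
    have "netflow E t h l {v} = b v" if v: "v \<in> V" for v
    proof (rule antisym)
      show "b v \<le> netflow E t h l {v}" using tight[of "{v}"] v capl by simp
      have *: "sum b V = b v + sum b (V - {v})" using fin v by (simp add: sum.remove)
      have "netflow E t h l V = netflow E t h l {v} + netflow E t h l (V - {v})"
        using netflow_sum_vertices[of V E t h l] netflow_sum_vertices[of "V - {v}" E t h l]
          sum.remove[OF fin(2) v, of "\<lambda>v. netflow E t h l {v}"] fin by simp
      moreover have "netflow E t h l V = 0" using inV by (rule netflow_vertices_eq_0[OF fin(2)])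
      moreover have "sum b (V - {v}) \<le> netflow E t h l (V - {v})" using tight[of "V - {v}"] capl by auto
      ultimately show "netflow E t h l {v} \<le> b v" using b0 * by linarith
    qed
    then show ?thesis using True by (intro exI[of _ l]) auto
  next
    case False
    then obtain e where e: "e \<in> E" "l e < c e" using lc by force
    define l' where "l' = l(e := l e + 1)"
    define c' where "c' = c(e := c e - 1)"
    have s: "(\<Sum>x\<in>E. c x - l' x) = (\<Sum>x\<in>E. c x - l x) - 1"
      "(\<Sum>x\<in>E. c' x - l x) = (\<Sum>x\<in>E. c x - l x) - 1"
      using e fin by (simp_all add: l'_def c'_def sum.remove[of E e])
    have lc1: "l' x \<le> c x" "l x \<le> c' x" if "x \<in> E" for x
      using lc that e by (auto simp: l'_def c'_def)
    have pos: "(\<Sum>x\<in>E. c x - l x) \<ge> 1"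
      using e fin lc by (simp add: sum.remove[of E e]) (smt (verit) sum_nonneg DiffD1)
    have "(\<forall>S\<subseteq>V. sum b S \<le> cut_capacity E t h l' c S) \<or> (\<forall>S\<subseteq>V. sum b S \<le> cut_capacity E t h l c' S)"
    proof (rule ccontr)
      assume "\<not> ?thesis"
      then obtain S T where S: "S \<subseteq> V" "cut_capacity E t h l' c S < sum b S"
        and T: "T \<subseteq> V" "cut_capacity E t h l c' T < sum b T" by (auto simp: not_le)
      have "cut_capacity E t h l' c S - cut_capacity E t h l c S =
          (\<Sum>x\<in>E. if x = e then (if h e \<in> S \<and> t e \<notin> S then - 1 else 0) else 0)"
        unfolding cut_capacity_def sum_subtractf[symmetric] by (intro sum.cong) (auto simp: l'_def)
      then have capS: "cut_capacity E t h l' c S = cut_capacity E t h l c S - (if h e \<in> S \<and> t e \<notin> S then 1 else 0)"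
        using e fin by (simp split: if_splits)
      have "cut_capacity E t h l c' T - cut_capacity E t h l c T =
          (\<Sum>x\<in>E. if x = e then (if t e \<in> T \<and> h e \<notin> T then - 1 else 0) else 0)"
        unfolding cut_capacity_def sum_subtractf[symmetric] by (intro sum.cong) (auto simp: c'_def)
      then have capT: "cut_capacity E t h l c' T = cut_capacity E t h l c T - (if t e \<in> T \<and> h e \<notin> T then 1 else 0)"
        using e fin by (simp split: if_splits)
      \<comment> \<open>All quantities are integers: a condition that fails after one bound moved by
        1 held with equality before, and \<open>e\<close> must enter \<open>S\<close> and leave
        \<open>T\<close>.\<close>
      have eS: "h e \<in> S" "t e \<notin> S" "cut_capacity E t h l c S = sum b S"
        using tight[OF S(1)] S(2) capS by (auto split: if_splits)
      have eT: "t e \<in> T" "h e \<notin> T" "cut_capacity E t h l c T = sum b T"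
        using tight[OF T(1)] T(2) capT by (auto split: if_splits)
      \<comment> \<open>\<open>e\<close> runs from \<open>T - S\<close> to \<open>S - T\<close>: it
        crosses neither the intersection nor the union, but contributes \<open>c e - l e > 0\<close>
        on the right, so submodularity is strict.\<close>
      have "cut_capacity E t h l c (S \<inter> T) + cut_capacity E t h l c (S \<union> T) < cut_capacity E t h l c S + cut_capacity E t h l c T"
        unfolding cut_capacity_def sum.distrib[symmetric]
      proof (rule sum_strict_mono_ex1[OF fin(1)])
        show "\<exists>e\<in>E. (if t e \<in> S \<inter> T \<and> h e \<notin> S \<inter> T then c e
            else if h e \<in> S \<inter> T \<and> t e \<notin> S \<inter> T then - l e else 0) +
          (if t e \<in> S \<union> T \<and> h e \<notin> S \<union> T then c e
            else if h e \<in> S \<union> T \<and> t e \<notin> S \<union> T then - l e else 0)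
          < (if t e \<in> S \<and> h e \<notin> S then c e else if h e \<in> S \<and> t e \<notin> S then - l e else 0) +
            (if t e \<in> T \<and> h e \<notin> T then c e else if h e \<in> T \<and> t e \<notin> T then - l e else 0)"
          using e eS eT by (intro bexI[of _ e]) auto
      qed (use lc in force)
      moreover have "sum b (S \<inter> T) + sum b (S \<union> T) = sum b S + sum b T"
        using sum.union_inter[of S T b] S T fin by (metis add.commute finite_subset)
      ultimately show False using tight[of "S \<inter> T"] tight[of "S \<union> T"] S T eS eT by force
    qed
    then show ?thesis
    proof
      assume "\<forall>S\<subseteq>V. sum b S \<le> cut_capacity E t h l' c S"
      then obtain f where "\<forall>e\<in>E. l' e \<le> f e \<and> f e \<le> c e" "\<forall>v\<in>V. netflow E t h f {v} = b v"
        using less.hyps[of c l'] lc1 s pos by auto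
      then show ?thesis by (intro exI[of _ f]) (auto simp: l'_def split: if_splits)
    next
      assume "\<forall>S\<subseteq>V. sum b S \<le> cut_capacity E t h l c' S"
      then obtain f where "\<forall>e\<in>E. l e \<le> f e \<and> f e \<le> c' e" "\<forall>v\<in>V. netflow E t h f {v} = b v"
        using less.hyps[of c' l] lc1 s pos by auto
      then show ?thesis by (intro exI[of _ f]) (auto simp: c'_def split: if_splits)
    qed
  qed
qed

text \<open>Connectivity gives every nontrivial cut an edge; when each edge has the total absolute
  demand \<open>N\<close> as capacity, one edge already satisfies Hoffman's condition.\<close>

lemma connected_demand:
  fixes b :: "'v \<Rightarrow> int"
  assumes "finite X" "finite W" "\<And>e. e \<in> X \<Longrightarrow> t e \<in> W \<and> h e \<in> W"
    and conn: "\<And>A. A \<inter> W \<noteq> {} \<Longrightarrow> W - A \<noteq> {} \<Longrightarrow> edge_cut X t h A \<noteq> {}"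
    and "sum b W = 0"
  shows "\<exists>g. \<forall>v\<in>W. netflow X t h g {v} = b v"
proof -
  define N where "N = (\<Sum>v\<in>W. \<bar>b v\<bar>)"
  have "0 \<le> N" by (simp add: N_def sum_nonneg)
  have "\<exists>g. (\<forall>e\<in>X. - N \<le> g e \<and> g e \<le> N) \<and> (\<forall>v\<in>W. netflow X t h g {v} = b v)"
  proof (rule feasible_flow)
    fix A assume A: "A \<subseteq> W"
    have "sum b A \<le> N * int (card (edge_cut X t h A))"
    proof (cases "A = {} \<or> A = W")
      case True
      then show ?thesis using assms(5) \<open>0 \<le> N\<close> by auto
    next
      case False
      then have "edge_cut X t h A \<noteq> {}" using A by (intro conn) auto
      then have "1 \<le> card (edge_cut X t h A)"
        using finite_edge_cut[OF assms(1)] by (metis One_nat_def Suc_leI card_gt_0_iff)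
      have "sum b A \<le> (\<Sum>v\<in>A. \<bar>b v\<bar>)" by (intro sum_mono) auto
      also have "\<dots> \<le> N" unfolding N_def using A assms(2) by (intro sum_mono2) auto
      also have "\<dots> \<le> N * int (card (edge_cut X t h A))"
        using \<open>0 \<le> N\<close> \<open>1 \<le> card (edge_cut X t h A)\<close> by (simp add: mult_le_cancel_left1)
      finally show ?thesis .
    qed
    then show "sum b A \<le> cut_capacity X t h (\<lambda>_. - N) (\<lambda>_. N) A" using assms(1) by (simp add: cut_capacity_const)
  qed (use assms \<open>0 \<le> N\<close> in auto)
  then show ?thesis by blast
qed

text \<open>Tutte's lifting of a flow modulo \<open>k\<close> to an integer flow: the edges whose residue
  \<open>r\<close> has to be replaced by \<open>r - k\<close> form a unit-capacity flow with prescribed demands.\<close>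

lemma integer_flow_of_mod_flow:
  fixes f :: "'e \<Rightarrow> int" and t h :: "'e \<Rightarrow> 'v"
  assumes fin: "finite E" and k: "k > 0" and div: "\<And>v. k dvd netflow E t h f {v}"
  shows "\<exists>F. (\<forall>e\<in>E. \<bar>F e\<bar> < k \<and> k dvd F e - f e) \<and> (\<forall>v. netflow E t h F {v} = 0)"
proof -
  define V where "V = t ` E \<union> h ` E"
  have V: "finite V" "\<And>e. e \<in> E \<Longrightarrow> t e \<in> V \<and> h e \<in> V" using fin by (auto simp: V_def)
  define r where "r = (\<lambda>e. f e mod k)"
  define q where "q = (\<lambda>e. f e div k)"
  have r: "r = (\<lambda>e. f e - k * q e)" by (simp add: r_def q_def minus_mult_div_eq_mod)
  have rb: "0 \<le> r e" "r e < k" for e using k by (auto simp: r_def)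
  have dr: "k dvd netflow E t h r {v}" for v
    unfolding r netflow_diff netflow_mult using div by simp
  define b where "b = (\<lambda>v. netflow E t h r {v} div k)"
  have b: "k * b v = netflow E t h r {v}" for v using dr by (simp add: b_def)
  have bS: "k * sum b S = netflow E t h r S" if "S \<subseteq> V" for S
    using that V(1) by (simp add: sum_distrib_left b netflow_sum_vertices finite_subset)
  \<comment> \<open>The capacity is 0 where the residue is 0: subtracting \<open>k\<close> there
    would give absolute value \<open>k\<close>.\<close>
  define u :: "'e \<Rightarrow> int" where "u = (\<lambda>e. if r e = 0 then 0 else 1)"
  have "\<exists>y. (\<forall>e\<in>E. 0 \<le> y e \<and> y e \<le> u e) \<and> (\<forall>v\<in>V. netflow E t h y {v} = b v)"
  proof (rule feasible_flow)
    have "k * sum b V = 0" using bS[of V] V by (simp add: netflow_vertices_eq_0)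
    then show "sum b V = 0" using k by simp
  next
    fix S assume S: "S \<subseteq> V"
    have "k * sum b S \<le> k * cut_capacity E t h (\<lambda>_. 0) u S"
      unfolding bS[OF S] unfolding netflow_def cut_capacity_def sum_distrib_left
      using rb k by (intro sum_mono) (auto simp: u_def less_imp_le)
    then show "sum b S \<le> cut_capacity E t h (\<lambda>_. 0) u S" using k by simp
  qed (use fin V in \<open>auto simp: u_def\<close>)
  then obtain y where y: "\<forall>e\<in>E. 0 \<le> y e \<and> y e \<le> u e" "\<forall>v\<in>V. netflow E t h y {v} = b v"
    by blast
  define F where "F = (\<lambda>e. r e - k * y e)"
  have "netflow E t h F {v} = 0" for v
  proof (cases "v \<in> V")
    case True
    then show ?thesis using y b by (simp add: F_def netflow_diff netflow_mult)
  next
    case False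
    then show ?thesis unfolding netflow_def using V by (intro sum.neutral) auto
  qed
  moreover have "\<bar>F e\<bar> < k \<and> k dvd F e - f e" if "e \<in> E" for e
  proof
    have "y e = 0 \<or> r e \<noteq> 0 \<and> y e = 1"
      using y(1)[rule_format, OF that] by (auto simp: u_def split: if_splits)
    then show "\<bar>F e\<bar> < k" using rb[of e] k by (auto simp: F_def)
    have "F e - f e = k * (- q e - y e)" by (simp add: F_def r algebra_simps)
    then show "k dvd F e - f e" by simp
  qed
  ultimately show ?thesis by blast
qed

subsection \<open>The 6-flow theorem\<close>

text \<open>The set \<open>W\<close> with the even subgraph \<open>X\<close> replaces the pair of edge-disjoint paths in
  Seymour's argument: inside a minimal set \<open>S\<close> left by at most one edge that avoids \<open>u\<close>,
  two units of flow can be sent between the ends of two edges from \<open>u\<close> to \<open>S\<close>.\<close>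

lemma even_subgraph_attached_twice:
  fixes t h :: "'e \<Rightarrow> 'v"
  assumes fin: "finite E" "finite V" and inV: "\<And>e. e \<in> E \<Longrightarrow> t e \<in> V \<and> h e \<in> V"
    and u: "u \<in> V" "V \<noteq> {u}"
    and cuts: "\<And>S. S \<subseteq> V - {u} \<Longrightarrow> S \<noteq> {} \<Longrightarrow> 3 \<le> card (edge_cut E t h S)"
  shows "\<exists>W X e1 e2. W \<subseteq> V - {u} \<and> W \<noteq> {} \<and> X \<subseteq> E \<and> (\<forall>e\<in>X. t e \<in> W \<and> h e \<in> W) \<and>
    (\<forall>v. even (netflow E t h (ind X) {v})) \<and>
    (\<forall>A. A \<inter> W \<noteq> {} \<longrightarrow> W - A \<noteq> {} \<longrightarrow> edge_cut X t h A \<noteq> {}) \<and>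
    e1 \<in> E \<and> e2 \<in> E \<and> e1 \<noteq> e2 \<and>
    (t e1 = u \<and> h e1 \<in> W \<or> h e1 = u \<and> t e1 \<in> W) \<and>
    (t e2 = u \<and> h e2 \<in> W \<or> h e2 = u \<and> t e2 \<in> W)"
proof -
  define Eu where "Eu = {e \<in> E. t e \<noteq> u \<and> h e \<noteq> u}"
  have finEu: "finite (edge_cut Eu t h A)" for A using fin by (auto simp: Eu_def edge_cut_def)
  \<comment> \<open>\<open>Eu\<close> is the graph without \<open>u\<close>. Proper nonempty subsets
    of a smallest \<open>S\<close> with \<open>P S\<close> are left by at least two edges of
    \<open>Eu\<close>.\<close>
  define P where "P S \<longleftrightarrow> S \<subseteq> V - {u} \<and> S \<noteq> {} \<and> card (edge_cut Eu t h S) \<le> 1" for S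
  have "edge_cut Eu t h (V - {u}) = {}" using inV by (auto simp: edge_cut_def Eu_def)
  then have "P (V - {u})" using u by (auto simp: P_def)
  then obtain S where S: "P S" "\<And>A. P A \<Longrightarrow> card S \<le> card A"
    using ex_has_least_nat[of P _ card] by blast
  have finS: "finite S" and Su: "S \<subseteq> V - {u}" using S(1) fin by (auto simp: P_def intro: finite_subset)
  have minS: "2 \<le> card (edge_cut Eu t h A)" if "A \<subset> S" "A \<noteq> {}" for A
    using S(2)[of A] psubset_card_mono[OF finS that(1)] that Su unfolding P_def by fastforce
  define J where "J = {e \<in> E. t e = u \<and> h e \<in> S \<or> h e = u \<and> t e \<in> S}"
  have finJ: "finite J" using fin by (simp add: J_def)
  \<comment> \<open>Of the at least three edges leaving \<open>S\<close> at most one lies in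
    \<open>Eu\<close>, so two go to \<open>u\<close>.\<close>
  have "edge_cut E t h S \<subseteq> edge_cut Eu t h S \<union> J" using Su by (auto simp: edge_cut_def Eu_def J_def)
  then have "card (edge_cut E t h S) \<le> card (edge_cut Eu t h S) + card J"
    using finEu finJ by (meson card_Un_le card_mono finite_Un le_trans)
  then have "2 \<le> card J" using cuts[of S] S(1) Su by (auto simp: P_def)
  then obtain T where T: "T \<subseteq> J" "card T = 2" using obtain_subset_with_card_n by metis
  then obtain e1 e2 where e: "e1 \<noteq> e2" "e1 \<in> J" "e2 \<in> J" by (auto simp: card_2_iff)
  define x where "x = (\<lambda>e. if t e = u then h e else t e)"
  have xS: "x e1 \<in> S" "x e2 \<in> S" using e Su by (auto simp: x_def J_def)
  have joined: "t e1 = u \<and> h e1 = x e1 \<or> h e1 = u \<and> t e1 = x e1"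
    "t e2 = u \<and> h e2 = x e2 \<or> h e2 = u \<and> t e2 = x e2"
    using e by (auto simp: x_def J_def)
  show ?thesis
  proof (cases "x e1 = x e2")
    case True
    show ?thesis
      by (rule exI[of _ "{x e1}"], rule exI[of _ "{}"], rule exI[of _ e1], rule exI[of _ e2])
        (use e xS Su joined True in \<open>auto simp: J_def netflow_def\<close>)
  next
    case False
    define ES where "ES = {e \<in> E. t e \<in> S \<and> h e \<in> S}"
    \<comment> \<open>Two units of demand under unit capacities stand for two edge-disjoint paths.
      As all demands are even and \<open>g\<close> is 1 or -1 on its support, that support is an
      even subgraph.\<close>
    define b where "b = (\<lambda>v. (if v = x e1 then 2 else 0) + (if v = x e2 then - 2 else 0 :: int))"
    have sumb: "sum b A = (if x e1 \<in> A then 2 else 0) + (if x e2 \<in> A then - 2 else 0)"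
      if "finite A" for A
      using that by (simp add: b_def sum.distrib)
    \<comment> \<open>At most one edge of \<open>Eu\<close> leaves \<open>S\<close>, and its end in
      \<open>S\<close> lies in only one of \<open>A\<close> and \<open>S - A\<close>. The cut edges
      of the other set, at least two, stay inside \<open>S\<close>, where both sets have the same
      cut.\<close>
    have two: "2 \<le> card (edge_cut ES t h A)" if A: "A \<subset> S" "A \<noteq> {}" for A
    proof -
      define C where "C B = {e \<in> edge_cut Eu t h S. t e \<in> B \<or> h e \<in> B}" for B
      have "edge_cut Eu t h A \<subseteq> edge_cut ES t h A \<union> C A" "edge_cut Eu t h (S - A) \<subseteq> edge_cut ES t h A \<union> C (S - A)"
        using A by (auto simp: edge_cut_def Eu_def ES_def C_def)
      moreover have finC: "finite (C B)" for B using finEu by (simp add: C_def)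
      moreover have "finite (edge_cut ES t h A)" using fin by (simp add: ES_def edge_cut_def)
      ultimately have "card (edge_cut Eu t h A) \<le> card (edge_cut ES t h A) + card (C A)"
        "card (edge_cut Eu t h (S - A)) \<le> card (edge_cut ES t h A) + card (C (S - A))"
        by (meson card_Un_le card_mono finite_Un le_trans)+
      moreover have "card (C A) + card (C (S - A)) = card (C A \<union> C (S - A))"
        by (intro card_Un_disjoint[symmetric] finC) (use A in \<open>auto simp: C_def edge_cut_def\<close>)
      moreover have "card (C A \<union> C (S - A)) \<le> card (edge_cut Eu t h S)"
        using finEu by (intro card_mono) (auto simp: C_def)
      moreover have "card (edge_cut Eu t h S) \<le> 1" using S(1) by (simp add: P_def)
      moreover have "2 \<le> card (edge_cut Eu t h A)" "2 \<le> card (edge_cut Eu t h (S - A))"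
        using minS[of A] minS[of "S - A"] A by auto
      ultimately show ?thesis by linarith
    qed
    have "\<exists>g. (\<forall>e\<in>ES. - 1 \<le> g e \<and> g e \<le> (1::int)) \<and> (\<forall>v\<in>S. netflow ES t h g {v} = b v)"
    proof (rule feasible_flow)
      show "sum b S = 0" using xS sumb[OF finS] by simp
      fix A assume A: "A \<subseteq> S"
      have "sum b A \<le> int (card (edge_cut ES t h A))"
        using two[of A] A xS sumb[of A] finite_subset[OF A finS] by (cases "x e1 \<in> A"; cases "x e2 \<in> A") auto
      then show "sum b A \<le> cut_capacity ES t h (\<lambda>_. - 1) (\<lambda>_. 1) A"
        using cut_capacity_const[of ES t h 1 A] fin by (simp add: ES_def)
    qed (use finS fin in \<open>auto simp: ES_def\<close>)
    then obtain g where g: "\<forall>v\<in>S. netflow ES t h g {v} = b v" "\<forall>e\<in>ES. - 1 \<le> g e \<and> g e \<le> (1::int)"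
      by blast
    define Y where "Y = {e \<in> ES. g e \<noteq> 0}"
    \<comment> \<open>The intersection \<open>W\<close> of all closed sets is the component of
      \<open>x e1\<close> in the support \<open>Y\<close>. No support edge leaves it, so its total
      demand is 0, which forces \<open>x e2\<close> into it.\<close>
    define closed where "closed A \<longleftrightarrow> A \<subseteq> S \<and> x e1 \<in> A \<and> (\<forall>e\<in>Y. t e \<in> A \<longleftrightarrow> h e \<in> A)" for A
    define W where "W = \<Inter> {A. closed A}"
    have closedS: "closed S" using xS by (auto simp: closed_def Y_def ES_def)
    have closedW: "closed W" using closedS by (auto simp: closed_def W_def)
    have WS: "W \<subseteq> S" "x e1 \<in> W" using closedW by (auto simp: closed_def)
    have "netflow ES t h g W = 0"
      using closedW fin by (subst netflow_edge_cut) (auto simp: ES_def Y_def closed_def edge_cut_def intro!: sum.neutral)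
    moreover have "netflow ES t h g W = sum b W"
      using WS finS g finite_subset[of W S] by (subst netflow_sum_vertices[symmetric]) (auto intro!: sum.cong)
    ultimately have x2W: "x e2 \<in> W"
      using WS sumb[of W] finite_subset[OF WS(1) finS] by (auto split: if_splits)
    define X where "X = {e \<in> Y. t e \<in> W}"
    have XW: "t e \<in> W \<and> h e \<in> W" if "e \<in> X" for e using closedW that by (auto simp: X_def closed_def)
    have even: "even (netflow E t h (ind X) {v})" for v
    proof (cases "v \<in> W")
      case True
      define g' where "g' = (\<lambda>e. if e \<in> ES then g e else 0)"
      have "even (netflow E t h (\<lambda>e. if e \<in> X then 1 else 0) {v} - netflow E t h g' {v})"
      proof (rule netflow_dvd_diff)
        fix e assume e: "e \<in> E" "t e \<in> {v} \<or> h e \<in> {v}"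
        have "e \<in> Y \<Longrightarrow> e \<in> X" using e True closedW by (auto simp: X_def closed_def)
        moreover have "e \<in> Y \<Longrightarrow> g e = 1 \<or> g e = - 1" using g(2) by (force simp: Y_def)
        ultimately show "even ((if e \<in> X then 1 else 0) - g' e)"
          by (cases "e \<in> ES"; cases "g e = 0") (auto simp: g'_def X_def Y_def)
      qed
      moreover have "netflow E t h g' {v} = netflow ES t h g {v}"
        unfolding netflow_def g'_def ES_def using fin by (intro sum.mono_neutral_cong_right) auto
      moreover have "even (b v)" by (simp add: b_def)
      ultimately show ?thesis using g(1) True WS by auto
    next
      case False
      have "netflow E t h (ind X) {v} = 0"
        unfolding netflow_def using XW False by (intro sum.neutral) auto
      then show ?thesis by simp
    qed
    have conn: "edge_cut X t h A \<noteq> {}" if A: "A \<inter> W \<noteq> {}" "W - A \<noteq> {}" for A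
    proof
      assume c: "edge_cut X t h A = {}"
      \<comment> \<open>If no edge of \<open>X\<close> crossed, the side of \<open>W\<close>
        containing \<open>x e1\<close> would be closed, against the minimality of
        \<open>W\<close>.\<close>
      define B where "B = (if x e1 \<in> A then A \<inter> W else W - A)"
      have YX: "t e \<in> W \<longleftrightarrow> e \<in> X" "h e \<in> W \<longleftrightarrow> e \<in> X" if "e \<in> Y" for e
        using that closedW by (auto simp: X_def closed_def)
      have "t e \<in> A \<longleftrightarrow> h e \<in> A" if "e \<in> X" for e using c that by (auto simp: edge_cut_def)
      then have "closed B" using WS YX by (auto simp: closed_def B_def)
      then have "W \<subseteq> B" by (auto simp: W_def)
      then show False using A by (auto simp: B_def split: if_splits)
    qed
    show ?thesis
    proof (intro exI conjI)
      show "X \<subseteq> E" by (auto simp: X_def Y_def ES_def)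
      show "\<forall>v. even (netflow E t h (ind X) {v})" using even by blast
      show "\<forall>A. A \<inter> W \<noteq> {} \<longrightarrow> W - A \<noteq> {} \<longrightarrow> edge_cut X t h A \<noteq> {}" using conn by blast
      show "e1 \<in> E" "e2 \<in> E" "e1 \<noteq> e2" using e by (auto simp: J_def)
      show "t e1 = u \<and> h e1 \<in> W \<or> h e1 = u \<and> t e1 \<in> W"
        "t e2 = u \<and> h e2 \<in> W \<or> h e2 = u \<and> t e2 \<in> W" using joined WS x2W by auto
    qed (use WS Su XW in auto)
  qed
qed

text \<open>Seymour's 2-closure argument as an induction: contracting \<open>u\<close> together with \<open>W\<close>, the
  even subgraph found in the contraction avoids the new vertex, hence stays even when the
  contraction is undone.  Two edges from \<open>u\<close> to \<open>W\<close> suffice, because modulo 3 every residue is a sum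
  of two nonzero ones.\<close>

lemma even_subgraph_and_mod_3_flow:
  fixes t h :: "'e \<Rightarrow> 'v"
  assumes fin: "finite E" "finite V" and inV: "\<And>e. e \<in> E \<Longrightarrow> t e \<in> V \<and> h e \<in> V"
    and u: "u \<in> V" and cuts: "\<And>S. S \<subseteq> V \<Longrightarrow> card (edge_cut E t h S) \<notin> {1, 2}"
  shows "\<exists>X f. X \<subseteq> E \<and> (\<forall>e\<in>X. t e \<noteq> u \<and> h e \<noteq> u) \<and> (\<forall>v. even (netflow E t h (ind X) {v})) \<and>
    (\<forall>v. 3 dvd netflow E t h f {v}) \<and> (\<forall>e\<in>E. e \<in> X \<or> \<not> 3 dvd (f e :: int))"
  using fin(2) inV u cuts
proof (induction "card V" arbitrary: V t h rule: less_induct)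
  case less
  note inV = less.prems(2) and u = less.prems(3) and cuts = less.prems(4)
  \<comment> \<open>The induction hypothesis for the graph with \<open>W\<close> contracted into
    \<open>u\<close>, read in the original graph: on \<open>insert u W\<close> conservation modulo 3
    holds only for the whole set and has to be repaired inside.\<close>
  have contract: "\<exists>X f. X \<subseteq> E \<and> (\<forall>e\<in>X. t e \<notin> insert u W \<and> h e \<notin> insert u W) \<and>
      (\<forall>v. even (netflow E t h (ind X) {v})) \<and>
      (\<forall>v. v \<notin> insert u W \<longrightarrow> 3 dvd netflow E t h f {v}) \<and> 3 dvd netflow E t h f (insert u W) \<and>
      (\<forall>e\<in>E. e \<in> X \<or> \<not> 3 dvd (f e :: int))" if W: "W \<subseteq> V - {u}" "W \<noteq> {}" for W
  proof -
    define p where "p = (\<lambda>v. if v \<in> W then u else v)"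
    let ?t = "\<lambda>e. p (t e)" and ?h = "\<lambda>e. p (h e)"
    have pu: "p -` {u} = insert u W" using W by (auto simp: p_def)
    have pv: "p -` {v} = {v}" if "v \<notin> insert u W" for v using that by (auto simp: p_def)
    have "\<exists>X f. X \<subseteq> E \<and> (\<forall>e\<in>X. ?t e \<noteq> u \<and> ?h e \<noteq> u) \<and> (\<forall>v. even (netflow E ?t ?h (ind X) {v})) \<and>
      (\<forall>v. 3 dvd netflow E ?t ?h f {v}) \<and> (\<forall>e\<in>E. e \<in> X \<or> \<not> 3 dvd (f e :: int))"
    proof (rule less.hyps)
      show "card (V - W) < card V" using W less.prems(1) by (intro psubset_card_mono) auto
      show "?t e \<in> V - W \<and> ?h e \<in> V - W" if "e \<in> E" for e
        using inV[OF that] W u by (auto simp: p_def)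
      fix S assume "S \<subseteq> V - W"
      then have "p -` S \<subseteq> V" using W u by (auto simp: p_def split: if_splits)
      then show "card (edge_cut E ?t ?h S) \<notin> {1, 2}" unfolding edge_cut_vimage[of E p t h] by (rule cuts)
    qed (use W u less.prems(1) in auto)
    then obtain X and f :: "'e \<Rightarrow> int" where Xf: "X \<subseteq> E" "\<forall>e\<in>X. ?t e \<noteq> u \<and> ?h e \<noteq> u"
      "\<forall>v. even (netflow E ?t ?h (ind X) {v})" "\<forall>v. 3 dvd netflow E ?t ?h f {v}"
      "\<forall>e\<in>E. e \<in> X \<or> \<not> 3 dvd f e" by blast
    have XW: "\<forall>e\<in>X. t e \<notin> insert u W \<and> h e \<notin> insert u W"
      using Xf(2) by (auto simp: p_def split: if_splits)
    have "even (netflow E t h (ind X) {v})" for v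
    proof (cases "v \<in> insert u W")
      case True
      then have "netflow E t h (ind X) {v} = 0" unfolding netflow_def using XW by (intro sum.neutral) auto
      then show ?thesis by simp
    next
      case False
      from Xf(3)[rule_format, of v] show ?thesis unfolding netflow_vimage[of E p t h] pv[OF False] .
    qed
    moreover have "3 dvd netflow E t h f {v}" if "v \<notin> insert u W" for v
      using Xf(4)[rule_format, of v] unfolding netflow_vimage[of E p t h] pv[OF that] .
    moreover have "3 dvd netflow E t h f (insert u W)"
      using Xf(4)[rule_format, of u] unfolding netflow_vimage[of E p t h] pu .
    ultimately show ?thesis using Xf XW by blast
  qed
  show ?case
  proof (cases "V = {u}")
    case True
    then have "netflow E t h f {v} = 0" for f :: "'e \<Rightarrow> int" and v
      unfolding netflow_def using inV by (intro sum.neutral) auto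
    then show ?thesis by (intro exI[of _ "{}"] exI[of _ "\<lambda>_. 1"]) simp
  next
    case nontrivial: False
    show ?thesis
    proof (cases "\<exists>S. S \<subseteq> V - {u} \<and> S \<noteq> {} \<and> edge_cut E t h S = {}")
      case True
      \<comment> \<open>No edge leaves \<open>S\<close>, and one vertex \<open>w\<close> of it is
        contracted into \<open>u\<close>. The total net flow of \<open>S\<close> is 0, which gives
        divisibility at \<open>w\<close> and then at \<open>u\<close>.\<close>
      then obtain S w where S: "S \<subseteq> V - {u}" "w \<in> S" "edge_cut E t h S = {}" by blast
      then have "{w} \<subseteq> V - {u}" "{w} \<noteq> {}" by auto
      from contract[OF this] obtain X and f :: "'e \<Rightarrow> int" where Xf: "X \<subseteq> E"
        "\<forall>e\<in>X. t e \<notin> {u, w} \<and> h e \<notin> {u, w}" "\<forall>v. even (netflow E t h (ind X) {v})"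
        "\<forall>v. v \<notin> {u, w} \<longrightarrow> 3 dvd netflow E t h f {v}" "3 dvd netflow E t h f {u, w}"
        "\<forall>e\<in>E. e \<in> X \<or> \<not> 3 dvd f e" by blast
      have finS: "finite S" using S less.prems(1) by (meson Diff_subset finite_subset)
      have "netflow E t h f S = 0" using S(3) fin(1) by (simp add: netflow_edge_cut)
      moreover have "netflow E t h f S = netflow E t h f {w} + (\<Sum>v\<in>S - {w}. netflow E t h f {v})"
        using S finS by (simp add: netflow_sum_vertices[of S, symmetric] sum.remove[of S w])
      moreover have "3 dvd (\<Sum>v\<in>S - {w}. netflow E t h f {v})" using S Xf(4) by (intro dvd_sum) auto
      ultimately have w: "3 dvd netflow E t h f {w}" by (metis dvd_0_right dvd_add_left_iff)
      have "u \<noteq> w" using S by auto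
      then have "netflow E t h f {u, w} = netflow E t h f {u} + netflow E t h f {w}"
        using \<open>u \<noteq> w\<close> netflow_sum_vertices[of "{u, w}" E t h f] by simp
      then have "3 dvd netflow E t h f {u}" using w Xf(5) by (metis dvd_add_left_iff)
      then have "3 dvd netflow E t h f {v}" for v using w Xf(4) by (cases "v \<in> {u, w}") auto
      then show ?thesis using Xf by (intro exI[of _ X] exI[of _ f]) auto
    next
      case False
      have cut3: "3 \<le> card (edge_cut E t h S)" if "S \<subseteq> V - {u}" "S \<noteq> {}" for S
      proof -
        have "card (edge_cut E t h S) \<noteq> 0" using False that finite_edge_cut[OF fin(1)] by (metis card_0_eq)
        then show ?thesis using cuts[of S] that by force
      qed
      have "\<exists>W X e1 e2. W \<subseteq> V - {u} \<and> W \<noteq> {} \<and> X \<subseteq> E \<and> (\<forall>e\<in>X. t e \<in> W \<and> h e \<in> W) \<and>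
          (\<forall>v. even (netflow E t h (ind X) {v})) \<and>
          (\<forall>A. A \<inter> W \<noteq> {} \<longrightarrow> W - A \<noteq> {} \<longrightarrow> edge_cut X t h A \<noteq> {}) \<and>
          e1 \<in> E \<and> e2 \<in> E \<and> e1 \<noteq> e2 \<and>
          (t e1 = u \<and> h e1 \<in> W \<or> h e1 = u \<and> t e1 \<in> W) \<and>
          (t e2 = u \<and> h e2 \<in> W \<or> h e2 = u \<and> t e2 \<in> W)"
        using fin(1) less.prems(1) inV u nontrivial cut3 by (rule even_subgraph_attached_twice)
      then obtain W X0 e1 e2 where W: "W \<subseteq> V - {u}" "W \<noteq> {}" and X0: "X0 \<subseteq> E"
        "\<forall>e\<in>X0. t e \<in> W \<and> h e \<in> W" "\<forall>v. even (netflow E t h (ind X0) {v})"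
        and conn: "\<forall>A. A \<inter> W \<noteq> {} \<longrightarrow> W - A \<noteq> {} \<longrightarrow> edge_cut X0 t h A \<noteq> {}"
        and e: "e1 \<in> E" "e2 \<in> E" "e1 \<noteq> e2"
          "t e1 = u \<and> h e1 \<in> W \<or> h e1 = u \<and> t e1 \<in> W"
          "t e2 = u \<and> h e2 \<in> W \<or> h e2 = u \<and> t e2 \<in> W"
        by (elim exE conjE) (rule that)
      from contract[OF W] obtain X and f :: "'e \<Rightarrow> int" where Xf: "X \<subseteq> E"
        "\<forall>e\<in>X. t e \<notin> insert u W \<and> h e \<notin> insert u W" "\<forall>v. even (netflow E t h (ind X) {v})"
        "\<forall>v. v \<notin> insert u W \<longrightarrow> 3 dvd netflow E t h f {v}" "3 dvd netflow E t h f (insert u W)"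
        "\<forall>e\<in>E. e \<in> X \<or> \<not> 3 dvd f e" by blast
      have finW: "finite W" using W less.prems(1) by (meson Diff_subset finite_subset)
      have uW: "u \<notin> W" using W by auto
      define I where "I = {e \<in> E. t e \<in> insert u W \<and> h e \<in> insert u W}"
      \<comment> \<open>Edges inside \<open>insert u W\<close> are loops of the contraction, so
        their values are free. They become 1, except on \<open>e1\<close>, \<open>e2\<close> and
        \<open>X0\<close>, whose values are adjusted below.\<close>
      define f0 where "f0 = (\<lambda>e. if e \<in> I then (if e \<in> X0 \<union> {e1, e2} then 0 else 1) else f e)"
      have eI: "e1 \<in> I" "e2 \<in> I" "e1 \<notin> X0" "e2 \<notin> X0" "X0 \<subseteq> I"
        using e X0 uW by (auto simp: I_def)
      have "\<exists>a1 a2 :: int. (a1 = 1 \<or> a1 = - 1) \<and> (a2 = 1 \<or> a2 = - 1) \<and>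
        3 dvd netflow E t h f0 {u} + ((if t e1 = u then 1 else - 1) * a1 + (if t e2 = u then 1 else - 1) * a2)"
      proof -
        have "\<exists>p q :: int. (p = 1 \<or> p = - 1) \<and> (q = 1 \<or> q = - 1) \<and> 3 dvd n + (p + q)" for n :: int
        proof -
          have "3 dvd n + (1 + - 1) \<or> 3 dvd n + (1 + 1) \<or> 3 dvd n + (- 1 + - 1)" by presburger
          then show ?thesis by blast
        qed
        then obtain p q :: int where "p = 1 \<or> p = - 1" "q = 1 \<or> q = - 1" "3 dvd netflow E t h f0 {u} + (p + q)"
          by blast
        then show ?thesis
          by - (rule exI[where x = "(if t e1 = u then 1 else - 1) * p"],
              rule exI[where x = "(if t e2 = u then 1 else - 1) * q"], auto)
      qed
      then obtain a1 a2 :: int where a: "a1 = 1 \<or> a1 = - 1" "a2 = 1 \<or> a2 = - 1"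
        "3 dvd netflow E t h f0 {u} + ((if t e1 = u then 1 else - 1) * a1 + (if t e2 = u then 1 else - 1) * a2)"
        by blast
      define f1 where "f1 = (\<lambda>e. f0 e + ((if e = e1 then a1 else 0) + (if e = e2 then a2 else 0)))"
      have net1: "netflow E t h f1 A = netflow E t h f0 A + (((if t e1 \<in> A then a1 else 0) - (if h e1 \<in> A then a1 else 0))
          + ((if t e2 \<in> A then a2 else 0) - (if h e2 \<in> A then a2 else 0)))" for A
        unfolding f1_def netflow_add netflow_single[OF fin(1) e(1)] netflow_single[OF fin(1) e(2)] ..
      have u1: "3 dvd netflow E t h f1 {u}"
      proof -
        have "h e1 = u \<longleftrightarrow> t e1 \<noteq> u" "h e2 = u \<longleftrightarrow> t e2 \<noteq> u" using e uW by auto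
        then show ?thesis using a(3) by (auto simp: net1 split: if_splits)
      qed
      have "netflow E t h f1 (insert u W) = netflow E t h f0 (insert u W)"
        using e by (auto simp: net1)
      also have "\<dots> = netflow E t h f (insert u W)"
        unfolding netflow_edge_cut[OF fin(1)] f0_def by (intro sum.cong) (auto simp: edge_cut_def I_def)
      finally have "3 dvd netflow E t h f1 (insert u W)" using Xf by simp
      moreover have "netflow E t h f1 (insert u W) = netflow E t h f1 {u} + netflow E t h f1 W"
        using finW uW netflow_sum_vertices[of "insert u W" E t h f1] netflow_sum_vertices[of W E t h f1] by simp
      ultimately have W1: "3 dvd netflow E t h f1 W" using u1 by (metis dvd_add_right_iff)
      obtain w where w: "w \<in> W" using W by blast
      \<comment> \<open>This demand cancels the net flow at each vertex of \<open>W\<close> and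
        collects the total, a multiple of 3, at \<open>w\<close>. Any values on \<open>X0\<close>
        will do, because these edges join the even subgraph.\<close>
      define b where "b = (\<lambda>v. (if v = w then netflow E t h f1 W else 0) - netflow E t h f1 {v})"
      have "sum b W = 0" using finW w by (simp add: b_def sum_subtractf netflow_sum_vertices)
      then obtain g where g: "\<forall>v\<in>W. netflow X0 t h g {v} = b v"
        using connected_demand[of X0 W t h b] X0 conn finW finite_subset[OF X0(1) fin(1)] by auto
      define f2 where "f2 = (\<lambda>e. f1 e + (if e \<in> X0 then g e else 0))"
      have net2: "netflow E t h f2 A = netflow E t h f1 A + netflow X0 t h g A" for A
        unfolding f2_def netflow_add using fin(1) X0(1) by (simp add: netflow_mono_neutral)
      have "3 dvd netflow E t h f2 {v}" for v
      proof -
        consider "v \<in> W" | "v = u" | "v \<notin> insert u W" by blast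
        then show ?thesis
        proof cases
          case 1
          then show ?thesis using g W1 by (auto simp: net2 b_def)
        next
          case 2
          have "netflow X0 t h g {u} = 0" unfolding netflow_def using X0(2) uW by (intro sum.neutral) auto
          then show ?thesis using u1 2 by (simp add: net2)
        next
          case 3
          have "netflow E t h f2 {v} = netflow E t h f {v}"
          proof (rule netflow_cong_incident)
            fix e assume "e \<in> E" "t e \<in> {v} \<or> h e \<in> {v}"
            then have "e \<notin> I" using 3 by (auto simp: I_def)
            then show "f2 e = f e" using eI by (auto simp: f2_def f1_def f0_def)
          qed
          then show ?thesis using Xf 3 by simp
        qed
      qed
      moreover have "e \<in> X \<union> X0 \<or> \<not> 3 dvd f2 e" if "e \<in> E" for e
        using Xf(6) that eI a(1,2) e(3) by (auto simp: f2_def f1_def f0_def)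
      moreover have "even (netflow E t h (ind (X \<union> X0)) {v})" for v
      proof -
        have "X \<inter> X0 = {}" using Xf(2) X0(2) by fastforce
        then have "netflow E t h (ind (X \<union> X0)) {v} = netflow E t h (\<lambda>e. ind X e + ind X0 e) {v}"
          by (intro netflow_cong) auto
        then show ?thesis using Xf(3) X0(3) by (simp add: netflow_add)
      qed
      moreover have "\<forall>e\<in>X \<union> X0. t e \<noteq> u \<and> h e \<noteq> u" using Xf(2) X0(2) uW by blast
      ultimately show ?thesis using Xf(1) X0(1) by (intro exI[of _ "X \<union> X0"] exI[of _ f2]) blast
    qed
  qed
qed

text \<open>A cut of two edges is removed by contracting one of them. Without such cuts,
  \<open>3 * ind X - 2 * f\<close> is congruent to the indicator of \<open>X\<close> modulo 2 and to
  \<open>f\<close> modulo 3, hence nowhere divisible by 6.\<close>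

lemma nowhere_zero_mod_6_flow:
  fixes t h :: "'e \<Rightarrow> 'v"
  assumes "finite E" "\<And>S. card (edge_cut E t h S) \<noteq> 1"
  shows "\<exists>f. (\<forall>v. 6 dvd netflow E t h f {v}) \<and> (\<forall>e\<in>E. \<not> 6 dvd (f e :: int))"
  using assms
proof (induction "card E" arbitrary: E t h rule: less_induct)
  case less
  note fin = less.prems(1) and cuts = less.prems(2)
  define V where "V = t ` E \<union> h ` E"
  have V: "finite V" "\<And>e. e \<in> E \<Longrightarrow> t e \<in> V \<and> h e \<in> V" using fin by (auto simp: V_def)
  show ?case
  proof (cases "\<exists>S. card (edge_cut E t h S) = 2")
    case True
    then obtain S where "card (edge_cut E t h S) = 2" by blast
    then obtain e e' where ee': "e \<noteq> e'" "edge_cut E t h S = {e, e'}" by (auto simp: card_2_iff)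
    then have "e \<in> edge_cut E t h S" "e' \<in> edge_cut E t h S" by auto
    then have e: "e \<in> E" "e' \<in> E" "t e \<noteq> h e" by (auto simp: edge_cut_def)
    define p where "p = (\<lambda>v. if v = h e then t e else v)"
    have pe: "p -` {t e} = {t e, h e}" using e by (auto simp: p_def split: if_splits)
    have pv: "p -` {v} = {v}" if "v \<noteq> t e" "v \<noteq> h e" for v using that by (auto simp: p_def)
    have "\<exists>f. (\<forall>v. 6 dvd netflow (E - {e}) (\<lambda>e. p (t e)) (\<lambda>e. p (h e)) f {v}) \<and>
        (\<forall>e\<in>E - {e}. \<not> 6 dvd (f e :: int))"
    proof (rule less.hyps)
      show "card (E - {e}) < card E" using fin e(1) by (rule card_Diff1_less)
      fix A
      have "edge_cut (E - {e}) (\<lambda>e. p (t e)) (\<lambda>e. p (h e)) A = edge_cut E t h (p -` A)"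
        by (auto simp: edge_cut_def p_def)
      then show "card (edge_cut (E - {e}) (\<lambda>e. p (t e)) (\<lambda>e. p (h e)) A) \<noteq> 1" using cuts by simp
    qed (use fin in auto)
    then obtain f :: "'e \<Rightarrow> int" where
      f: "\<And>v. 6 dvd netflow (E - {e}) (\<lambda>e. p (t e)) (\<lambda>e. p (h e)) f {v}" "\<And>x. x \<in> E - {e} \<Longrightarrow> \<not> 6 dvd f x"
      by blast
    have fe: "6 dvd netflow (E - {e}) t h f {t e, h e}"
      using f(1)[of "t e"] unfolding netflow_vimage[of _ p t h] pe .
    have fv: "6 dvd netflow (E - {e}) t h f {v}" if "v \<noteq> t e" "v \<noteq> h e" for v
      using f(1)[of v] unfolding netflow_vimage[of _ p t h] pv[OF that] .
    \<comment> \<open>This gives conservation at the tail of \<open>e\<close>; at the head it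
      follows modulo 6 from the contracted vertex. Across the cut the values on \<open>e\<close> and
      \<open>e'\<close> agree up to sign modulo 6, so \<open>e\<close> inherits a nonzero
      one.\<close>
    define a where "a = - netflow (E - {e}) t h f {t e}"
    define g where "g = (\<lambda>x. if x = e then a else f x)"
    have g: "netflow E t h g A = netflow (E - {e}) t h f A + ((if t e \<in> A then a else 0) - (if h e \<in> A then a else 0))" for A
    proof -
      have "netflow (E - {e}) t h g A = netflow (E - {e}) t h f A" by (rule netflow_cong) (simp add: g_def)
      moreover have "netflow E t h g A =
          ((if t e \<in> A then g e else 0) - (if h e \<in> A then g e else 0)) + netflow (E - {e}) t h g A"
        unfolding netflow_def by (rule sum.remove[OF fin e(1)])
      moreover have "g e = a" by (simp add: g_def)
      ultimately show ?thesis by simp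
    qed
    have div: "6 dvd netflow E t h g {v}" for v
    proof -
      consider "v = t e" | "v = h e" | "v \<noteq> t e" "v \<noteq> h e" by blast
      then show ?thesis
      proof cases
        case 2
        have "netflow (E - {e}) t h f {t e, h e} = netflow (E - {e}) t h f {t e} + netflow (E - {e}) t h f {h e}"
          using e netflow_sum_vertices[of "{t e, h e}" "E - {e}" t h f] by simp
        then show ?thesis using fe 2 e by (simp add: g a_def add.commute)
      qed (use e fv in \<open>simp_all add: g a_def\<close>)
    qed
    have "\<not> 6 dvd g e"
    proof
      assume "6 dvd g e"
      have "6 dvd (\<Sum>v\<in>S \<inter> V. netflow E t h g {v})" using div by (intro dvd_sum) auto
      then have "6 dvd netflow E t h g (S \<inter> V)" using V by (simp add: netflow_sum_vertices)
      moreover have "edge_cut E t h (S \<inter> V) = {e, e'}" using ee' V by (auto simp: edge_cut_def)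
      ultimately have "6 dvd (if t e \<in> S \<inter> V then g e else - g e) + (if t e' \<in> S \<inter> V then g e' else - g e')"
        using ee'(1) fin by (simp add: netflow_edge_cut)
      moreover have "6 dvd (if t e \<in> S \<inter> V then g e else - g e)" using \<open>6 dvd g e\<close> by simp
      ultimately have "6 dvd (if t e' \<in> S \<inter> V then g e' else - g e')" using dvd_add_right_iff by blast
      then have "6 dvd g e'" by (simp split: if_splits)
      then show False using f(2)[of e'] e ee' by (simp add: g_def)
    qed
    then show ?thesis using div f(2) by (intro exI[of _ g]) (auto simp: g_def)
  next
    case False
    show ?thesis
    proof (cases "E = {}")
      case True
      then show ?thesis by (simp add: netflow_def)
    next
      case nonempty: False
      then obtain u where u: "u \<in> V" by (auto simp: V_def)
      have "\<exists>X f. X \<subseteq> E \<and> (\<forall>e\<in>X. t e \<noteq> u \<and> h e \<noteq> u) \<and> (\<forall>v. even (netflow E t h (ind X) {v})) \<and>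
          (\<forall>v. 3 dvd netflow E t h f {v}) \<and> (\<forall>e\<in>E. e \<in> X \<or> \<not> 3 dvd (f e :: int))"
        using fin V u by (rule even_subgraph_and_mod_3_flow) (use cuts False in auto)
      then obtain X and f :: "'e \<Rightarrow> int" where X: "\<forall>v. even (netflow E t h (ind X) {v})"
        and f: "\<forall>v. 3 dvd netflow E t h f {v}" "\<forall>e\<in>E. e \<in> X \<or> \<not> 3 dvd f e" by blast
      define g where "g = (\<lambda>e. 3 * ind X e - 2 * f e)"
      have "6 dvd netflow E t h g {v}" for v
      proof -
        have "netflow E t h g {v} = 3 * netflow E t h (ind X) {v} - 2 * netflow E t h f {v}"
          unfolding g_def netflow_diff netflow_mult ..
        then show ?thesis using X[rule_format, of v] f(1)[rule_format, of v] by presburger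
      qed
      moreover have "\<not> 6 dvd g e" if "e \<in> E" for e
        using f(2)[rule_format, OF that] unfolding g_def by (cases "e \<in> X") (simp_all, presburger+)
      ultimately show ?thesis by blast
    qed
  qed
qed

text \<open>Lifting the modulo 6 flow modulo 2 and modulo 3 gives \<open>x\<close> and
  \<open>F\<close>. Lifting \<open>F\<close> modulo 2 gives \<open>y\<close>; half the sum and half
  the difference of \<open>F\<close> and \<open>y\<close> are \<open>a\<close> and \<open>b\<close>,
  and the ranges and equal parity of \<open>F\<close> and \<open>y\<close> leave only the seven
  pairs.\<close>

lemma two_flow_and_split_three_flow:
  fixes t h :: "'e \<Rightarrow> 'v"
  assumes "finite E" "\<And>S. card (edge_cut E t h S) \<noteq> 1"
  obtains x a b :: "'e \<Rightarrow> int" where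
    "\<And>v. netflow E t h x {v} = 0" "\<And>v. netflow E t h a {v} = 0" "\<And>v. netflow E t h b {v} = 0"
    "\<And>e. e \<in> E \<Longrightarrow> x e \<in> {- 1, 0, 1}"
    "\<And>e. e \<in> E \<Longrightarrow> (a e, b e) \<in> {(0, 0), (1, 0), (0, 1), (1, 1), (- 1, 0), (0, - 1), (- 1, - 1)}"
    "\<And>e. e \<in> E \<Longrightarrow> x e = 0 \<Longrightarrow> (a e, b e) \<noteq> (0, 0)"
proof -
  obtain f :: "'e \<Rightarrow> int" where f: "\<And>v. 6 dvd netflow E t h f {v}" "\<And>e. e \<in> E \<Longrightarrow> \<not> 6 dvd f e"
    using nowhere_zero_mod_6_flow[OF assms] by blast
  have "2 dvd netflow E t h f {v}" "3 dvd netflow E t h f {v}" for v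
    using f(1)[of v] by presburger+
  then obtain x F where "\<forall>e\<in>E. \<bar>x e\<bar> < 2 \<and> 2 dvd x e - f e" "\<forall>v. netflow E t h x {v} = 0"
    "\<forall>e\<in>E. \<bar>F e\<bar> < 3 \<and> 3 dvd F e - f e" "\<forall>v. netflow E t h F {v} = 0"
    using integer_flow_of_mod_flow[OF assms(1), of 2 t h f] integer_flow_of_mod_flow[OF assms(1), of 3 t h f]
    by (metis zero_less_numeral)
  then have x: "\<And>e. e \<in> E \<Longrightarrow> \<bar>x e\<bar> < 2 \<and> 2 dvd x e - f e" "\<And>v. netflow E t h x {v} = 0"
    and F: "\<And>e. e \<in> E \<Longrightarrow> \<bar>F e\<bar> < 3 \<and> 3 dvd F e - f e" "\<And>v. netflow E t h F {v} = 0"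
    by blast+
  obtain y where "\<forall>e\<in>E. \<bar>y e\<bar> < 2 \<and> 2 dvd y e - F e" "\<forall>v. netflow E t h y {v} = 0"
    using integer_flow_of_mod_flow[OF assms(1), of 2 t h F] F(2) by (metis dvd_0_right zero_less_numeral)
  then have y: "\<And>e. e \<in> E \<Longrightarrow> \<bar>y e\<bar> < 2 \<and> 2 dvd y e - F e" "\<And>v. netflow E t h y {v} = 0" by blast+
  define a where "a = (\<lambda>e. (F e + y e) div 2)"
  define b where "b = (\<lambda>e. F e - a e)"
  have a2: "2 * a e = F e + y e" if "e \<in> E" for e using y(1)[OF that] unfolding a_def by presburger
  have neta: "netflow E t h a {v} = 0" for v
  proof -
    have "2 * netflow E t h a {v} = netflow E t h (\<lambda>e. F e + y e) {v}"
      unfolding netflow_mult[symmetric] using a2 by (rule netflow_cong)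
    then show ?thesis using F y by (simp add: netflow_add)
  qed
  show ?thesis
  proof (rule that[of x a b])
    show "netflow E t h b {v} = 0" for v using F neta by (simp add: b_def netflow_diff)
    fix e assume e: "e \<in> E"
    have "x e = - 1 \<or> x e = 0 \<or> x e = 1" using x(1)[OF e] by presburger
    then show "x e \<in> {- 1, 0, 1}" by simp
    have "(a e = 0 \<and> b e = 0) \<or> (a e = 1 \<and> b e = 0) \<or> (a e = 0 \<and> b e = 1) \<or> (a e = 1 \<and> b e = 1) \<or>
      (a e = - 1 \<and> b e = 0) \<or> (a e = 0 \<and> b e = - 1) \<or> (a e = - 1 \<and> b e = - 1)"
      using a2[OF e] y(1)[OF e] F(1)[OF e] unfolding b_def by presburger
    then show "(a e, b e) \<in> {(0, 0), (1, 0), (0, 1), (1, 1), (- 1, 0), (0, - 1), (- 1, - 1)}" by auto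
    assume x0: "x e = 0"
    show "(a e, b e) \<noteq> (0, 0)"
    proof
      assume "(a e, b e) = (0, 0)"
      then have "F e = 0" by (simp add: b_def)
      then have "2 dvd f e" "3 dvd f e" using x(1)[OF e] F(1)[OF e] x0 by auto
      then have "6 dvd f e" by presburger
      then show False using f(2)[OF e] by simp
    qed
  qed (use x neta in auto)
qed

subsection \<open>Power inequalities\<close>

text \<open>Weak majorization for the increasing convex function \<open>t powr p\<close> on
  nonnegative numbers.\<close>

lemma powr_add_le_of_majorized:
  fixes a b c d p :: real
  assumes p: "1 \<le> p" and "0 \<le> b" "0 \<le> c" "0 \<le> d" "c \<le> a" "d \<le> a" and le: "c + d \<le> a + b"
  shows "c powr p + d powr p \<le> a powr p + b powr p"
proof -
  \<comment> \<open>Convexity is applied to positive numbers, so \<open>b = 0\<close> is separate.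
    In the last case \<open>c\<close> lies between \<open>b\<close> and \<open>a\<close>, and
    \<open>d\<close> is at most the mirror image of \<open>c\<close> in that interval.\<close>
  consider "b = 0" | "c \<le> b" | "d \<le> b" | "0 < b" "b < c" "b < d" using assms by linarith
  then show ?thesis
  proof cases
    case 1
    have *: "x powr p = x * x powr (p - 1)" if "0 \<le> x" for x
      using that powr_add[of x 1 "p - 1"] by simp
    have "c powr p + d powr p \<le> c * a powr (p - 1) + d * a powr (p - 1)"
      unfolding *[OF \<open>0 \<le> c\<close>] *[OF \<open>0 \<le> d\<close>] using assms
      by (intro add_mono mult_left_mono powr_mono2) auto
    also have "\<dots> = (c + d) * a powr (p - 1)" by (simp add: algebra_simps)
    also have "\<dots> \<le> a * a powr (p - 1)" using le 1 by (intro mult_right_mono) auto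
    also have "\<dots> = a powr p" using * assms by simp
    finally show ?thesis using 1 assms by simp
  next
    case 2
    then show ?thesis using assms powr_mono2[of p c b] powr_mono2[of p d a] by simp
  next
    case 3
    then show ?thesis using assms powr_mono2[of p d b] powr_mono2[of p c a] by simp
  next
    case 4
    show ?thesis
    proof (cases "a = b")
      case True
      then show ?thesis using 4 assms by simp
    next
      case False
      then have ab: "b < a" using 4 assms by linarith
      define s where "s = (c - b) / (a - b)"
      have s: "0 \<le> s" "s \<le> 1" using 4 assms ab by (auto simp: s_def field_simps)
      have "s * (a - b) = c - b" using ab by (simp add: s_def)
      then have c: "c = (1 - s) * b + s * a" and d: "d \<le> (1 - s) * a + s * b"
        using le by (auto simp: algebra_simps)
      have conv: "((1 - s) * x + s * y) powr p \<le> (1 - s) * x powr p + s * y powr p"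
        if "0 < x" "0 < y" for x y
        using convex_onD[OF powr_convex[OF p] s, of x y] that by simp
      have "c powr p \<le> (1 - s) * b powr p + s * a powr p" unfolding c using 4 ab by (intro conv) auto
      moreover have "d powr p \<le> ((1 - s) * a + s * b) powr p" using d 4 p by (intro powr_mono2) auto
      moreover have "\<dots> \<le> (1 - s) * a powr p + s * b powr p" using 4 ab by (intro conv) auto
      ultimately show ?thesis by (simp add: algebra_simps)
    qed
  qed
qed

text \<open>As a function of \<open>q\<close>, \<open>y powr q\<close> is an exponential and hence
  convex; the right side is its chord between the exponents 1 and 2.\<close>

lemma powr_le_interpolation:
  fixes y q :: real
  assumes "0 < y" "1 \<le> q" "q \<le> 2"
  shows "y powr q \<le> (2 - q) * y + (q - 1) * y\<^sup>2"
proof -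
  have "exp ((1 - (q - 1)) * ln y + (q - 1) * (2 * ln y)) \<le> (1 - (q - 1)) * exp (ln y) + (q - 1) * exp (2 * ln y)"
    using convex_onD[OF exp_convex, of "q - 1" "ln y" "2 * ln y"] assms by simp
  moreover have "exp (2 * ln y) = y\<^sup>2" using assms(1) by (metis exp_double exp_ln)
  moreover have "exp ((1 - (q - 1)) * ln y + (q - 1) * (2 * ln y)) = y powr q"
    using assms(1) by (simp add: powr_def algebra_simps)
  ultimately show ?thesis using assms(1) by (simp add: algebra_simps)
qed

text \<open>The final numerical estimate for \<open>g2\<close>, with equality at
  \<open>p = 2\<close>. Tangents to the exponential suffice, with rounded constants: at
  \<open>p = 1\<close> up to \<open>6 / 5\<close>, at \<open>p = 2\<close> beyond.\<close>

lemma two_powr_half_bound: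
  fixes p :: real
  assumes p: "1 \<le> p" "p \<le> 2"
  shows "4 / 3 + (p - 1) * (8 / 9 - 4 / (9 * p)) \<le> 2 powr (p / 2)"
proof (cases "p \<le> 6 / 5")
  case True
  have "4 / 3 + (p - 1) * (8 / 9 - 4 / (9 * p)) \<le> 4 / 3 + (p - 1) * (14 / 27)"
    using p True by (intro add_left_mono mult_left_mono) (auto simp: field_simps)
  also have "\<dots> \<le> 1.41 * (1 + (p - 1) / 3)" using True by (simp add: field_simps)
  also have "\<dots> \<le> 2 powr (1 / 2) * 2 powr ((p - 1) / 2)"
  proof (rule mult_mono)
    show "(1.41 :: real) \<le> 2 powr (1 / 2)"
      unfolding powr_half_sqrt[of 2, simplified] by (rule real_le_rsqrt) (simp add: power2_eq_square)
    have "(p - 1) / 3 \<le> (p - 1) / 2 * ln 2"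
      using mult_left_mono[OF ln2_ge_two_thirds, of "(p - 1) / 2"] p by simp
    also have "1 + \<dots> \<le> exp ((p - 1) / 2 * ln 2)" by (rule exp_ge_add_one_self)
    finally show "1 + (p - 1) / 3 \<le> 2 powr ((p - 1) / 2)" by (simp add: powr_def)
  qed (use p in auto)
  also have "\<dots> = 2 powr (p / 2)" unfolding powr_add[symmetric] by (simp add: field_simps)
  finally show ?thesis .
next
  case False
  \<comment> \<open>This is the difference of the two sides times \<open>9 * p\<close>; its roots
    are 2 and \<open>20 / 17\<close>, the latter below \<open>6 / 5\<close>.\<close>
  have "0 \<le> (2 - p) * (17 / 10 * p - 2)" using p False by (intro mult_nonneg_nonneg) auto
  also have "\<dots> = 9 * p * (2 * (1 - (1 - p / 2) * (7 / 10))) - (12 * p + (p - 1) * (8 * p - 4))"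
    by (simp add: field_simps)
  finally have "12 * p + (p - 1) * (8 * p - 4) \<le> 9 * p * (2 * (1 - (1 - p / 2) * (7 / 10)))"
    by simp
  moreover have "12 * p + (p - 1) * (8 * p - 4) = 9 * p * (4 / 3 + (p - 1) * (8 / 9 - 4 / (9 * p)))"
    using p by (simp add: field_simps)
  ultimately have "9 * p * (4 / 3 + (p - 1) * (8 / 9 - 4 / (9 * p))) \<le> 9 * p * (2 * (1 - (1 - p / 2) * (7 / 10)))"
    by simp
  then have "4 / 3 + (p - 1) * (8 / 9 - 4 / (9 * p)) \<le> 2 * (1 - (1 - p / 2) * (7 / 10))"
    using p by simp
  also have "\<dots> \<le> 2 * (1 - (1 - p / 2) * ln 2)"
    using mult_left_mono[of "ln 2" "7 / 10" "1 - p / 2"] ln2_le_25_over_36 p by simp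
  also have "\<dots> \<le> 2 * 2 powr (p / 2 - 1)"
    using exp_ge_add_one_self[of "(p / 2 - 1) * ln 2"] by (simp add: powr_def algebra_simps)
  also have "\<dots> = 2 powr (p / 2)" by (simp add: powr_diff)
  finally show ?thesis .
qed

lemma root_powr: "0 < x \<Longrightarrow> p \<noteq> 0 \<Longrightarrow> (x powr (- 1 / p)) powr p = 1 / (x :: real)"
  by (simp only: powr_powr) (simp add: powr_minus_divide)

text \<open>With \<open>s\<close> factored out, the bracket involves
  \<open>(1 + x) powr p + (1 - x) powr p\<close>, and interpolating the exponent bounds it by
  \<open>4 / 3 + (p - 1) * x\<^sup>2\<close>. The same interpolation with exponent
  \<open>2 / p\<close> bounds \<open>x\<^sup>2\<close>.\<close>

lemma g2_le_sqrt_2: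
  fixes p :: real
  assumes p: "1 \<le> p" "p \<le> 2"
  shows "g2 (ereal p) \<le> sqrt 2"
proof -
  define s :: real where "s = 2 powr (- 1 / p)"
  define x :: real where "x = (2 / 3) powr (1 / p)"
  have s: "0 < s" "s powr p = 1 / 2" using p root_powr[of 2 p] unfolding s_def by auto
  have sx: "3 powr (- 1 / p) = s * x"
    using p by (simp add: s_def x_def powr_divide powr_minus_divide)
  have x: "0 < x" "x < 1" using p powr_less_mono2[of "1 / p" "2 / 3" 1] by (auto simp: x_def)
  have x2: "x\<^sup>2 \<le> 8 / 9 - 4 / (9 * p)"
  proof -
    have "x\<^sup>2 = (2 / 3) powr (2 / p)" by (simp add: x_def powr_powr flip: powr_numeral)
    also have "\<dots> \<le> (2 - 2 / p) * (2 / 3) + (2 / p - 1) * (2 / 3)\<^sup>2"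
      using p by (intro powr_le_interpolation) (auto simp: field_simps)
    also have "\<dots> = 8 / 9 - 4 / (9 * p)" using p by (simp add: field_simps power2_eq_square)
    finally show ?thesis .
  qed
  let ?X = "(2 powr (- 1 / p) + 3 powr (- 1 / p)) powr p
    + (2 powr (- 1 / p) - 3 powr (- 1 / p)) powr p + 1 / 3"
  have "?X = (s * (1 + x)) powr p + (s * (1 - x)) powr p + 1 / 3"
    unfolding sx s_def[symmetric] by (simp add: algebra_simps)
  also have "\<dots> = s powr p * ((1 + x) powr p + (1 - x) powr p) + 1 / 3"
    unfolding powr_mult by (simp add: distrib_left)
  also have "\<dots> \<le> 1 / 2 * (((2 - p) * (1 + x) + (p - 1) * (1 + x)\<^sup>2) + ((2 - p) * (1 - x) + (p - 1) * (1 - x)\<^sup>2)) + 1 / 3"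
    unfolding s using p x by (intro add_mono mult_left_mono powr_le_interpolation) auto
  also have "\<dots> = 4 / 3 + (p - 1) * x\<^sup>2" by (simp add: power2_eq_square algebra_simps)
  also have "\<dots> \<le> 4 / 3 + (p - 1) * (8 / 9 - 4 / (9 * p))" using x2 p by (intro add_left_mono mult_left_mono) auto
  also have "\<dots> \<le> 2 powr (p / 2)" using p by (rule two_powr_half_bound)
  finally have "?X powr (1 / p) \<le> (2 powr (p / 2)) powr (1 / p)"
    using p by (intro powr_mono2) auto
  also have "\<dots> = sqrt 2" using p by (simp add: powr_powr powr_half_sqrt)
  finally show ?thesis by (simp add: g2_def extend_at_infinity_def)
qed

subsection \<open>Vector flows\<close>

lemma equiv_reachability: "equiv (mverts G) ((adjacency G)\<^sup>* \<inter> mverts G \<times> mverts G)"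
proof -
  have "sym (adjacency G)" by (auto simp: sym_def adjacency_def insert_commute)
  then have "sym ((adjacency G)\<^sup>*)" by (rule sym_rtrancl)
  then show ?thesis
    unfolding equiv_def refl_on_def sym_def trans_def by (auto intro: rtrancl_trans)
qed

text \<open>The only edge of a cut is a bridge: after its deletion reachability respects
  \<open>S\<close>, so its ends lie in different components. Sending each component to the component
  of \<open>G\<close> containing it is surjective but merges these two, so the deletion raises the
  number of components.\<close>

lemma bridgeless_imp_no_singleton_cut:
  assumes G: "finite_loopless_multigraph G" "bridgeless G" and D: "orientation G D"
  shows "card (edge_cut (arcs D) (tail D) (head D) S) \<noteq> 1"
proof
  assume "card (edge_cut (arcs D) (tail D) (head D) S) = 1"
  then obtain e where e: "edge_cut (arcs D) (tail D) (head D) S = {e}" by (rule card_1_singletonE)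
  then have "e \<in> edge_cut (arcs D) (tail D) (head D) S" by simp
  then have eG: "e \<in> medges G" and eS: "(tail D e \<in> S) \<noteq> (head D e \<in> S)"
    using D by (auto simp: edge_cut_def orientation_def)
  have ends: "mends G a = {tail D a, head D a}" "tail D a \<in> mverts G" "head D a \<in> mverts G"
    if "a \<in> medges G" for a
    using D G(1) that by (auto simp: orientation_def finite_loopless_multigraph_def)
  let ?G' = "delete_edge G e"
  define V where "V = mverts G"
  define K where "K = (adjacency G)\<^sup>* \<inter> V \<times> V"
  define K' where "K' = (adjacency ?G')\<^sup>* \<inter> V \<times> V"
  have eqK: "equiv V K" using equiv_reachability[of G] by (simp add: K_def V_def)
  have eqK': "equiv V K'" using equiv_reachability[of ?G'] by (simp add: K'_def V_def delete_edge_def)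
  have "adjacency ?G' \<subseteq> adjacency G" by (auto simp: adjacency_def delete_edge_def)
  then have sub: "K' \<subseteq> K" unfolding K_def K'_def using rtrancl_mono by blast
  have step: "u \<in> S \<longleftrightarrow> v \<in> S" if uv: "(u, v) \<in> adjacency ?G'" for u v
  proof -
    obtain a where a: "a \<in> medges G" "a \<noteq> e" "mends G a = {u, v}"
      using uv by (auto simp: adjacency_def delete_edge_def)
    have "a \<notin> edge_cut (arcs D) (tail D) (head D) S" using a e by auto
    then have "tail D a \<in> S \<longleftrightarrow> head D a \<in> S" using a D by (auto simp: edge_cut_def orientation_def)
    then show ?thesis using ends(1)[OF a(1)] a(3) by (auto simp: doubleton_eq_iff)
  qed
  have "u \<in> S \<longleftrightarrow> v \<in> S" if "(u, v) \<in> (adjacency ?G')\<^sup>*" for u v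
    using that by (induction rule: rtrancl_induct) (auto dest: step)
  then have nK': "(tail D e, head D e) \<notin> K'" using eS by (auto simp: K'_def)
  have "(tail D e, head D e) \<in> adjacency G" using ends(1)[OF eG] eG by (auto simp: adjacency_def)
  then have inK: "(tail D e, head D e) \<in> K" using ends[OF eG] by (auto simp: K_def V_def)
  have img: "K `` (K' `` {x}) = K `` {x}" if "x \<in> V" for x
  proof -
    have "(x, x) \<in> K'" using eqK' that by (auto simp: equiv_def refl_on_def)
    moreover have "trans K" using eqK by (simp add: equiv_def)
    ultimately show ?thesis using sub by (auto dest: transD)
  qed
  have "(\<lambda>C. K `` C) ` (V // K') = V // K"
    unfolding quotient_def using img by (auto simp: image_iff) 
  moreover have fin: "finite (V // K')"
    using G(1) eqK' by (intro finite_quotient) (auto simp: V_def finite_loopless_multigraph_def K'_def)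
  moreover have "\<not> inj_on (\<lambda>C. K `` C) (V // K')"
  proof
    assume inj: "inj_on (\<lambda>C. K `` C) (V // K')"
    have V: "tail D e \<in> V" "head D e \<in> V" using ends[OF eG] by (simp_all add: V_def)
    have "K `` {tail D e} = K `` {head D e}" using inK eqK by (rule equiv_class_eq[rotated])
    then have "K' `` {tail D e} = K' `` {head D e}"
      using inj_onD[OF inj] V by (simp add: img quotientI)
    then show False using nK' V eqK' by (auto simp: eq_equiv_class_iff)
  qed
  ultimately have "card (V // K) < card (V // K')"
    by (metis card_image_le eq_card_imp_inj_on le_neq_implies_less)
  then have "bridge G e"
    using eG by (simp add: bridge_def graph_components_def K_def K'_def V_def delete_edge_def)
  then show False using G(2) by (simp add: bridgeless_def)
qed

lemma orientation_exists:
  assumes "finite_loopless_multigraph G"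
  obtains D where "orientation G D"
proof -
  have "\<forall>e\<in>medges G. \<exists>x y. mends G e = {x, y}"
    using assms unfolding finite_loopless_multigraph_def card_2_iff by blast
  then obtain a b where "\<forall>e\<in>medges G. mends G e = {a e, b e}" by metis
  then have "orientation G \<lparr>verts = mverts G, arcs = medges G, tail = a, head = b\<rparr>"
    by (simp add: orientation_def)
  then show ?thesis by (rule that)
qed

section \<open>From integer flows to vector flows\<close>

lemma sum_out_arcs_minus_sum_in_arcs:
  assumes "finite (arcs D)"
  shows "(\<Sum>e\<in>out_arcs D v. f e) - (\<Sum>e\<in>in_arcs D v. f e) = netflow (arcs D) (tail D) (head D) f {v}"
  using assms by (simp add: netflow_def sum_subtractf sum.inter_filter out_arcs_def in_arcs_def)

lemma netflow_scaleR_const: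
  "netflow E t h (\<lambda>e. of_int (x e) *\<^sub>R (u :: 'a::real_vector)) A = of_int (netflow E t h x A) *\<^sub>R u"
  unfolding netflow_def of_int_sum scaleR_left.sum by (intro sum.cong) (auto simp: scaleR_left_diff_distrib)

text \<open>Up to sign, which \<open>pnorm\<close> ignores, the flow takes only the ten listed
  values: hexagon vectors where \<open>x\<close> is 0, else \<open>u\<close> alone or
  \<open>u\<close> plus or minus a hexagon vector. The bound \<open>1 \<le> r\<close> yields
  \<open>2 \<le> 1 + r\<close> for \<open>NZF\<close>.\<close>

lemma flow_number_le:
  fixes G :: "('v, 'e) multigraph" and u v w :: "real ^ 'd::finite"
  assumes G: "finite_loopless_multigraph G" "bridgeless G" and p: "1 \<le> p" and r: "1 \<le> r"
    and norms: "\<And>z. z \<in> {u, v, w, v + w, u + v, u + w, u + (v + w), u - v, u - w, u - (v + w)} \<Longrightarrow>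
      1 \<le> pnorm p z \<and> pnorm p z \<le> r"
  shows "flow_number TYPE('d) p G \<le> ereal (1 + r)"
proof -
  obtain D where D: "orientation G D" using orientation_exists[OF G(1)] .
  have arcs: "arcs D = medges G" "finite (arcs D)"
    using D G(1) by (auto simp: orientation_def finite_loopless_multigraph_def)
  obtain x a b :: "'e \<Rightarrow> int" where
    flow: "\<And>v. netflow (arcs D) (tail D) (head D) x {v} = 0" "\<And>v. netflow (arcs D) (tail D) (head D) a {v} = 0"
      "\<And>v. netflow (arcs D) (tail D) (head D) b {v} = 0"
    and val: "\<And>e. e \<in> arcs D \<Longrightarrow> x e \<in> {- 1, 0, 1}"
      "\<And>e. e \<in> arcs D \<Longrightarrow> (a e, b e) \<in> {(0, 0), (1, 0), (0, 1), (1, 1), (- 1, 0), (0, - 1), (- 1, - 1)}"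
      "\<And>e. e \<in> arcs D \<Longrightarrow> x e = 0 \<Longrightarrow> (a e, b e) \<noteq> (0, 0)"
    using two_flow_and_split_three_flow[OF arcs(2) bridgeless_imp_no_singleton_cut[OF G D]] by metis
  define f where "f = (\<lambda>e. of_int (x e) *\<^sub>R u + (of_int (a e) *\<^sub>R v + of_int (b e) *\<^sub>R w))"
  have minus: "pnorm p (- z) = pnorm p z" for z :: "real ^ 'd" by (simp add: pnorm_def)
  have f: "1 \<le> pnorm p (f e) \<and> pnorm p (f e) \<le> r" if e: "e \<in> medges G" for e
  proof -
    let ?N = "{u, v, w, v + w, u + v, u + w, u + (v + w), u - v, u - w, u - (v + w)}"
    have "f e \<in> ?N \<or> - f e \<in> ?N"
      using val[of e] e unfolding arcs f_def by (auto simp: algebra_simps)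
    then show ?thesis using norms minus by metis
  qed
  have zero: "pnorm p (0 :: real ^ 'd) = 0" using p by (simp add: pnorm_def)
  have "vector_flow (UNIV - {0}) G D f"
    unfolding vector_flow_def
  proof (intro conjI ballI)
    fix e assume "e \<in> medges G"
    then show "f e \<in> UNIV - {0}" using f[of e] zero by auto
  next
    fix v' assume "v' \<in> mverts G"
    show "(\<Sum>e\<in>out_arcs D v'. f e) - (\<Sum>e\<in>in_arcs D v'. f e) = 0"
      unfolding sum_out_arcs_minus_sum_in_arcs[OF arcs(2)] f_def netflow_add netflow_scaleR_const flow by simp
  qed (rule D)
  then have "NZF (1 + r) p G D f" using p r f by (auto simp: NZF_def)
  then show ?thesis unfolding flow_number_def by (intro INF_lower) blast
qed

text \<open>Scaling by \<open>L powr (- 1 / p)\<close> turns power sums between \<open>L\<close> and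
  \<open>r powr p * L\<close> into norms between 1 and \<open>r\<close>, so the vectors need not be
  normalized.\<close>

lemma flow_number_le_powr:
  fixes G :: "('v, 'e) multigraph" and u v w :: "real ^ 3" and p r L :: real
  assumes G: "finite_loopless_multigraph G" "bridgeless G" and p: "1 \<le> p" and L: "0 < L" and r: "0 < r"
    and norms: "\<And>z. z \<in> {u, v, w, v + w, u + v, u + w, u + (v + w), u - v, u - w, u - (v + w)} \<Longrightarrow>
      L \<le> \<bar>z $ 1\<bar> powr p + \<bar>z $ 2\<bar> powr p + \<bar>z $ 3\<bar> powr p \<and>
      \<bar>z $ 1\<bar> powr p + \<bar>z $ 2\<bar> powr p + \<bar>z $ 3\<bar> powr p \<le> r powr p * L"
  shows "flow_number TYPE(3) (ereal p) G \<le> ereal (1 + r)"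
proof -
  define c where "c = L powr (- 1 / p)"
  have c: "0 < c" "c powr p = 1 / L" using L p root_powr[of L p] unfolding c_def by auto
  have "L \<le> r powr p * L" using norms[of u] by (meson insertI1 order_trans)
  then have rp: "1 \<le> r powr p" using L by simp
  have r1: "1 \<le> r"
  proof (rule ccontr)
    assume "\<not> 1 \<le> r"
    then have "r powr p < 1 powr p" using r p by (intro powr_less_mono2) auto
    then show False using rp by simp
  qed
  have n: "1 \<le> pnorm (ereal p) (c *\<^sub>R z) \<and> pnorm (ereal p) (c *\<^sub>R z) \<le> r"
    if "z \<in> {u, v, w, v + w, u + v, u + w, u + (v + w), u - v, u - w, u - (v + w)}" for z
  proof -
    define S where "S = \<bar>z $ 1\<bar> powr p + \<bar>z $ 2\<bar> powr p + \<bar>z $ 3\<bar> powr p"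
    have S: "L \<le> S" "S \<le> r powr p * L" using norms[OF that] by (auto simp: S_def)
    have "pnorm (ereal p) (c *\<^sub>R z) = (S / L) powr (1 / p)"
      using c by (simp add: pnorm_def sum_3 abs_mult powr_mult S_def add_divide_distrib)
    moreover have "1 powr (1 / p) \<le> (S / L) powr (1 / p)"
      using S L p by (intro powr_mono2) auto
    moreover have "(S / L) powr (1 / p) \<le> (r powr p) powr (1 / p)"
      using S L p by (intro powr_mono2) (auto simp: field_simps)
    moreover have "(r powr p) powr (1 / p) = r" using r p by (simp add: powr_powr)
    ultimately show ?thesis by simp
  qed
  show ?thesis
  proof (rule flow_number_le[OF G, of _ _ "c *\<^sub>R u" "c *\<^sub>R v" "c *\<^sub>R w"])
    fix z assume "z \<in> {c *\<^sub>R u, c *\<^sub>R v, c *\<^sub>R w, c *\<^sub>R v + c *\<^sub>R w, c *\<^sub>R u + c *\<^sub>R v, c *\<^sub>R u + c *\<^sub>R w,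
      c *\<^sub>R u + (c *\<^sub>R v + c *\<^sub>R w), c *\<^sub>R u - c *\<^sub>R v, c *\<^sub>R u - c *\<^sub>R w, c *\<^sub>R u - (c *\<^sub>R v + c *\<^sub>R w)}"
    then have "z \<in> (*\<^sub>R) c ` {u, v, w, v + w, u + v, u + w, u + (v + w), u - v, u - w, u - (v + w)}"
      by (simp add: scaleR_right_distrib scaleR_right_diff_distrib)
    then show "1 \<le> pnorm (ereal p) z \<and> pnorm (ereal p) z \<le> r" using n by blast
  qed (use p r1 in auto)
qed

section \<open>Vector configurations for the three bounds\<close>

lemma flow_number_le_g3:
  fixes G :: "('v, 'e) multigraph" and p :: real
  assumes G: "finite_loopless_multigraph G" "bridgeless G" and p: "1 \<le> p"
  shows "flow_number TYPE(3) (ereal p) G \<le> ereal (1 + g3 (ereal p))"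
proof -
  \<comment> \<open>With \<open>(1 / 2) powr p + b powr p = 1\<close> the hexagon, in the last two
    coordinates, consists of unit vectors. As \<open>u\<close> is the unit vector of the first,
    every mixed vector has power sum 2.\<close>
  define b where "b = (1 - (1 / 2) powr p) powr (1 / p)"
  have "(1 / 2) powr p \<le> (1 :: real)" using p by (intro powr_le1) auto
  then have b: "\<bar>b\<bar> powr p = 1 - (1 / 2) powr p" using p by (simp add: b_def powr_powr)
  have two: "(2 powr (1 / p)) powr p = (2 :: real)" using p by (simp add: powr_powr)
  have "flow_number TYPE(3) (ereal p) G \<le> ereal (1 + 2 powr (1 / p))"
    by (rule flow_number_le_powr[OF G p, where L = 1 and u = "vector [1, 0, 0]" and
          v = "vector [0, 1, 0]" and w = "vector [0, - 1 / 2, b]"])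
      (use p b two in auto)
  then show ?thesis by (simp add: g3_def extend_at_infinity_def)
qed

lemma flow_number_le_g2:
  fixes G :: "('v, 'e) multigraph" and p :: real
  assumes G: "finite_loopless_multigraph G" "bridgeless G" and p: "1 \<le> p"
  shows "flow_number TYPE(3) (ereal p) G \<le> ereal (1 + g2 (ereal p))"
proof -
  \<comment> \<open>\<open>s\<close> normalizes the hexagon, whose vectors have entries
    \<open>s\<close>, \<open>- s\<close>, 0 in some order, and \<open>r\<close> normalizes
    \<open>u\<close>. Mixed vectors have entries \<open>s + r\<close>, \<open>s - r\<close>,
    \<open>r\<close> up to sign and order, hence power sum \<open>X\<close>.\<close>
  define s :: real where "s = 2 powr (- 1 / p)"
  define r :: real where "r = 3 powr (- 1 / p)"
  define X where "X = (s + r) powr p + (s - r) powr p + 1 / 3"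
  have pw: "s powr p = 1 / 2" "r powr p = 1 / 3" and pos: "0 < s" "0 < r"
    using p root_powr[of 2 p] root_powr[of 3 p] unfolding s_def r_def by auto
  have rs: "r \<le> s" unfolding r_def s_def using p powr_mono2'[of "- 1 / p" 2 3] by simp
  \<comment> \<open>The pair \<open>s + r\<close>, 0 majorizes \<open>s\<close>, \<open>r\<close>,
    whose powers sum to \<open>5 / 6\<close>; adding \<open>1 / 3\<close> exceeds 1.\<close>
  have "s powr p + r powr p \<le> (s + r) powr p + 0 powr p"
    using p pos by (intro powr_add_le_of_majorized) auto
  then have "5 / 6 \<le> (s + r) powr p" using pw by simp
  then have X: "1 \<le> X" unfolding X_def using powr_ge_zero[of "s - r" p] by linarith
  have Xp: "(X powr (1 / p)) powr p = X" using X p by (simp add: powr_powr)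
  have abs: "\<bar>s\<bar> = s" "\<bar>r\<bar> = r" "\<bar>s + r\<bar> = s + r" "\<bar>s - r\<bar> = s - r" "\<bar>r + s\<bar> = s + r" "\<bar>r - s\<bar> = s - r"
    using rs pos by auto
  have "flow_number TYPE(3) (ereal p) G \<le> ereal (1 + X powr (1 / p))"
    by (rule flow_number_le_powr[OF G p, where L = 1 and u = "vector [r, r, r]" and
          v = "vector [s, - s, 0]" and w = "vector [0, s, - s]"])
      (use X in \<open>auto simp: Xp[unfolded X_def] abs pw X_def\<close>)
  then show ?thesis by (simp add: g2_def extend_at_infinity_def X_def s_def r_def)
qed

lemma flow_number_le_g1:
  fixes G :: "('v, 'e) multigraph" and p :: real
  assumes G: "finite_loopless_multigraph G" "bridgeless G" and p: "1 \<le> p"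
  shows "flow_number TYPE(3) (ereal p) G \<le> ereal (1 + g1 (ereal p))"
proof -
  \<comment> \<open>By majorization all values of $\|z\|_p^p$ lie between \<open>L\<close> and \<open>7 powr p + 3 powr p\<close>,
    whose ratio is \<open>g1 p powr p\<close>.\<close>
  define L :: real where "L = 2 * (14 / 5) powr p + 2 * (6 / 5) powr p"
  define r :: real where "r = 5 / 4 * 2 powr (1 - 1 / p)"
  have "r powr p = (5 / 4) powr p * (2 powr (1 - 1 / p)) powr p" unfolding r_def powr_mult ..
  moreover have e: "(1 - 1 / p) * p = p - 1" using p by (simp add: field_simps)
  moreover have "(2 powr (1 - 1 / p)) powr p = (2 :: real) powr p / 2"
    by (simp only: powr_powr e) (simp add: powr_diff)
  ultimately have rp: "r powr p = (5 / 4) powr p * 2 powr p / 2" by simp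
  have "r powr p * L = (5 / 4 * 2 * (14 / 5)) powr p + (5 / 4 * 2 * (6 / 5)) powr p"
    unfolding rp powr_mult L_def by (simp add: distrib_left)
  then have rL: "r powr p * L = 7 powr p + 3 powr p" by simp
  note mj = powr_add_le_of_majorized[OF p]
  have mono: "x powr p \<le> y powr p" if "0 \<le> x" "x \<le> y" for x y :: real
    using that p by (intro powr_mono2) auto
  \<comment> \<open>Four entries against three: the excess \<open>1 / 5\<close> of each 3 over
    \<open>14 / 5\<close> is carried along as an auxiliary entry that cancels when the three
    inequalities are added.\<close>
  have lo: "2 * (14 / 5) powr p + 2 * (6 / 5) powr p \<le> 3 powr p + 3 powr p + 2 powr p"
    using mj[of 0 "14 / 5" "1 / 5" 3] mj[of "1 / 5" "14 / 5" "2 / 5" 3] mj[of "2 / 5" "6 / 5" "6 / 5" 2]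
    by simp
  have four: "(14 / 5) powr p + (6 / 5) powr p \<le> 4 powr p"
    using mj[of 0 "14 / 5" "6 / 5" 4] by simp
  have lo2: "(14 / 5) powr p + (6 / 5) powr p \<le> 1 + 3 powr p"
    using mj[of 1 "14 / 5" "6 / 5" 3] by simp
  have lo3: "2 * (14 / 5) powr p + 2 * (6 / 5) powr p \<le> 7 powr p + 1 + 2 powr p"
    using mj[of 0 4 "14 / 5" 7] four mono[of "6 / 5" 2] by simp
  have lo4: "2 * (14 / 5) powr p + 2 * (6 / 5) powr p \<le> 6 powr p + 2 powr p + 2 powr p"
    using mj[of 0 "14 / 5" "14 / 5" 6] mono[of "6 / 5" 2] by simp
  have up1: "3 powr p + 2 powr p \<le> 7 powr p" "2 * 4 powr p \<le> 7 powr p + 3 powr p"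
    "1 + 4 powr p \<le> 7 powr p" "1 + 2 powr p \<le> 3 powr p" "4 powr p + 6 powr p \<le> 7 powr p + 3 powr p"
    "2 * 2 powr p \<le> 4 powr p"
    using mj[of 0 3 2 7] mj[of 3 4 4 7] mj[of 0 1 4 7] mj[of 0 1 2 3] mj[of 3 4 6 7] mj[of 0 2 2 4]
    by simp_all
  have m46: "4 powr p \<le> 6 powr p" by (rule mono) auto
  \<comment> \<open>Up to sign and order the entries are 3, 3, 2 for \<open>u\<close>; 4, 4, 0 for
    \<open>v\<close>; 1, 3, 4 for \<open>w\<close> and \<open>v + w\<close>; 7, 1, 2 for
    \<open>u + v\<close> and \<open>u - v\<close>; 4, 6, 0 for \<open>u + w\<close> and
    \<open>u + (v + w)\<close>; 6, 2, 2 for \<open>u - w\<close> and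
    \<open>u - (v + w)\<close>.\<close>
  have "flow_number TYPE(3) (ereal p) G \<le> ereal (1 + r)"
  proof (rule flow_number_le_powr[OF G p, where L = L and u = "vector [3, 3, 2]" and
          v = "vector [- 4, 4, 0]" and w = "vector [1, - 3, 4]"])
    show "0 < L" by (simp add: L_def add_pos_pos)
    show "0 < r" by (simp add: r_def)
  qed (unfold rL, unfold L_def, use lo four lo2 lo3 lo4 up1 m46 in auto)
  then show ?thesis by (simp add: g1_def extend_at_infinity_def r_def)
qed

text \<open>All ten vectors have entries among -1, 0, 1 and hence maximum norm 1, matching
  \<open>g3\<close>, the smallest of the three limits.\<close>

lemma flow_number_infinity_le:
  fixes G :: "('v, 'e) multigraph"
  assumes G: "finite_loopless_multigraph G" "bridgeless G"
  shows "flow_number TYPE(3) \<infinity> G \<le> ereal 2"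
proof -
  have pn: "pnorm \<infinity> z = max \<bar>z $ 1\<bar> (max \<bar>z $ 2\<bar> \<bar>z $ 3\<bar>)" for z :: "real ^ 3"
    by (simp add: pnorm_def UNIV_3)
  have "flow_number TYPE(3) \<infinity> G \<le> ereal (1 + 1)"
    by (rule flow_number_le[OF G, where u = "vector [1, 0, 0] :: real ^ 3" and
          v = "vector [0, 1, 0]" and w = "vector [0, - 1, 1]"]) (auto simp: pn)
  then show ?thesis by simp
qed

theorem theorem1p8:
  fixes G :: "('v, 'e) multigraph" and p :: ereal
  assumes "finite_loopless_multigraph G" and "bridgeless G" and "1 \<le> p"
  shows "flow_number TYPE(3) p G \<le> ereal (1 + Min {g1 p, g2 p, g3 p}) \<and>
         1 + Min {g1 p, g2 p, g3 p} \<le> 1 + sqrt 2"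
proof (cases p)
  case (real q)
  then have q: "1 \<le> q" using assms(3) by simp
  have "Min {g1 p, g2 p, g3 p} \<in> {g1 p, g2 p, g3 p}" by (rule Min_in) auto
  then have "flow_number TYPE(3) p G \<le> ereal (1 + Min {g1 p, g2 p, g3 p})"
    using flow_number_le_g1[OF assms(1,2) q] flow_number_le_g2[OF assms(1,2) q]
      flow_number_le_g3[OF assms(1,2) q] real by auto
  \<comment> \<open>\<open>g2\<close> serves up to exponent 2; from there on \<open>g3\<close>,
    which decreases and equals \<open>sqrt 2\<close> at 2.\<close>
  moreover have "g2 p \<le> sqrt 2 \<or> g3 p \<le> sqrt 2"
  proof (cases "q \<le> 2")
    case True
    then show ?thesis using g2_le_sqrt_2[OF q] real by simp
  next
    case False
    then have "2 powr (1 / q) \<le> 2 powr (1 / 2 :: real)" by (intro powr_mono) auto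
    then show ?thesis using real powr_half_sqrt[of 2] by (simp add: g3_def extend_at_infinity_def)
  qed
  ultimately show ?thesis by auto
next
  case PInf
  then have "Min {g1 p, g2 p, g3 p} = 1" by (simp add: g1_infinity g2_infinity g3_infinity)
  then show ?thesis using flow_number_infinity_le[OF assms(1,2)] PInf by simp
next
  case MInf
  then show ?thesis using assms(3) by simp
qed

end
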